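(* Let $f\colon I\to I$, $I=[0,1]$, be a surjective continuous map such that: (i) $f$ has exactly one infinite $\omega$-limit set $\tilde\omega$, and $f$ has zero topological entropy; (ii) $f$ is not Li–Yorke chaotic; (iii) the simple set $M(\tilde\omega)$ has non-empty interior; (iv) the non-degenerate connected components of $M(\tilde\omega)$ can be indexed as $\{G_n\}_{n\in\mathbb Z}$ with $f(G_n)=G_{n+1}$ for all $n\in\mathbb Z$. Then there is a sequence $f_{1,\infty}=(f_1,f_2,\dots)$ of surjective continuous maps $I\to I$ such that (1) $f_{1,\infty}$ converges uniformly to $f$; (2) there is a strictly increasing sequence $S$ of positive integers with $h_S(f_{1,\infty})\ge\log3$; (3) the nonautonomous system $(I,f_{1,\infty})$ is not Li–Yorke chaotic.
   Context: For $f\in C(I)$ and $x\in I$, the $\omega$-limit set of $x$ is the set of limit points of $(f^n(x))_{n\ge1}$. Associated system: if $h(f)=0$ and $\tilde\omega$ is an infinite $\omega$-limit set, there is a system $\{J(n,k):n\ge0,0\le k<2^n\}$ of compact intervals, where for each $n$ the intervals $J(n,0),\dots,J(n,2^n-1)$ form the orbit of a minimal $f$-periodic interval of period $2^n$ whose union contains $\tilde\omega$, with $J(n+1,0)\subset J(n,0)$; the simple set is $M(\tilde\omega)=\bigcap_{n\ge0}\bigcup_{0\le k<2^n}J(n,k)$. NDS $(X,f_{1,\infty})$: compact metric space $(X,\varrho)$ and continuous maps $f_n\colon X\to X$; iterates $f_1^0=\mathrm{id}$, $f_1^n=f_n\circ\dots\circ f_1$. Li–Yorke pair: distinct $x,y$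 with $\limsup_n\varrho(f_1^nx,f_1^ny)>0$ and $\liminf_n\varrho(f_1^nx,f_1^ny)=0$; Li–Yorke chaotic: there is an uncountable set any two distinct points of which form a Li–Yorke pair (for an autonomous map $f$ use $f_n=f$ for all $n$). Topological sequence entropy: for strictly increasing $A=(a_i)$ of positive integers, $\varrho_n^A(x,y)=\max_{1\le j\le n}\varrho(f_1^{a_j}x,f_1^{a_j}y)$; $E$ is $(n,\varepsilon,A)$-separated if $\varrho_n^A(x,y)>\varepsilon$ for distinct $x,y\in E$; $s_n^A(f_{1,\infty},\varepsilon)$ is the maximal cardinality of such $E$; $h_A(f_{1,\infty})=\lim_{\varepsilon\to0}\limsup_{n\to\infty}\frac1n\log s_n^A(f_{1,\infty},\varepsilon)$. Topological entropy is the case $a_i=i$. *)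

theory Defs
  imports "HOL-Analysis.Analysis"
begin

abbreviation unitI :: "real set" where "unitI \<equiv> {0..1}"

text \<open>Iterates of a nonautonomous system: f_1^0 = id, f_1^n = f_n o ... o f_1
  (the maps are fs 1, fs 2, ...; fs 0 is unused).\<close>
fun nds_iter :: "(nat \<Rightarrow> real \<Rightarrow> real) \<Rightarrow> nat \<Rightarrow> real \<Rightarrow> real" where
  "nds_iter fs 0 = id"
| "nds_iter fs (Suc n) = fs (Suc n) \<circ> nds_iter fs n"

definition omega_limit :: "(real \<Rightarrow> real) \<Rightarrow> real \<Rightarrow> real set" where
  "omega_limit f x = {y. \<forall>e>0. \<forall>N. \<exists>n\<ge>max N 1. \<bar>(f ^^ n) x - y\<bar> < e}"

definition is_omega_limit_set :: "(real \<Rightarrow> real) \<Rightarrow> real set \<Rightarrow> bool" where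
  "is_omega_limit_set f W \<longleftrightarrow> (\<exists>x\<in>unitI. W = omega_limit f x)"

text \<open>(n,e,A)-separated sets; A is a strictly increasing sequence of positive integers,
  indexed from 0 here: a_1 = A 0, a_2 = A 1, ...\<close>
definition separated :: "(nat \<Rightarrow> real \<Rightarrow> real) \<Rightarrow> (nat \<Rightarrow> nat) \<Rightarrow> nat \<Rightarrow> real \<Rightarrow> real set \<Rightarrow> bool" where
  "separated fs A n e E \<longleftrightarrow> E \<subseteq> unitI \<and>
     (\<forall>x\<in>E. \<forall>y\<in>E. x \<noteq> y \<longrightarrow> (\<exists>j<n. \<bar>nds_iter fs (A j) x - nds_iter fs (A j) y\<bar> > e))"

text \<open>Maximal cardinality of an (n,e,A)-separated set (finite by compactness).\<close>
definition sep_num :: "(nat \<Rightarrow> real \<Rightarrow> real) \<Rightarrow> (nat \<Rightarrow> nat) \<Rightarrow> nat \<Rightarrow> real \<Rightarrow> nat" where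
  "sep_num fs A n e = Sup {card E | E. finite E \<and> separated fs A n e E}"

text \<open>Topological sequence entropy h_A; the limit e -> 0 of a quantity that is
  nonincreasing in e is written as the supremum over e > 0.\<close>
definition seq_entropy :: "(nat \<Rightarrow> real \<Rightarrow> real) \<Rightarrow> (nat \<Rightarrow> nat) \<Rightarrow> ereal" where
  "seq_entropy fs A = (SUP e\<in>{0<..}. limsup (\<lambda>n. ereal (ln (real (sep_num fs A n e)) / real n)))"

definition top_entropy :: "(real \<Rightarrow> real) \<Rightarrow> ereal" where
  "top_entropy f = seq_entropy (\<lambda>_. f) (\<lambda>i. Suc i)"

definition li_yorke_pair :: "(nat \<Rightarrow> real \<Rightarrow> real) \<Rightarrow> real \<Rightarrow> real \<Rightarrow> bool" where
  "li_yorke_pair fs x y \<longleftrightarrow> x \<noteq> y \<and>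
     limsup (\<lambda>n. ereal \<bar>nds_iter fs n x - nds_iter fs n y\<bar>) > 0 \<and>
     liminf (\<lambda>n. ereal \<bar>nds_iter fs n x - nds_iter fs n y\<bar>) = 0"

definition li_yorke_chaotic :: "(nat \<Rightarrow> real \<Rightarrow> real) \<Rightarrow> bool" where
  "li_yorke_chaotic fs \<longleftrightarrow> (\<exists>S\<subseteq>unitI. uncountable S \<and>
     (\<forall>x\<in>S. \<forall>y\<in>S. x \<noteq> y \<longrightarrow> li_yorke_pair fs x y))"

definition periodic_interval :: "(real \<Rightarrow> real) \<Rightarrow> nat \<Rightarrow> real set \<Rightarrow> bool" where
  "periodic_interval f m J \<longleftrightarrow> (\<exists>a b. a \<le> b \<and> J = {a..b}) \<and> J \<subseteq> unitI \<and> m \<ge> 1 \<and>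
     (f ^^ m) ` J = J \<and>
     (\<forall>i<m. \<forall>j<m. i \<noteq> j \<longrightarrow> (f ^^ i) ` J \<inter> (f ^^ j) ` J = {})"

definition periodic_orbit_union :: "(real \<Rightarrow> real) \<Rightarrow> nat \<Rightarrow> real set \<Rightarrow> real set" where
  "periodic_orbit_union f m J = (\<Union>k<m. (f ^^ k) ` J)"

definition assoc_system :: "(real \<Rightarrow> real) \<Rightarrow> real set \<Rightarrow> (nat \<Rightarrow> nat \<Rightarrow> real set) \<Rightarrow> bool" where
  "assoc_system f W J \<longleftrightarrow>
     (\<forall>n. periodic_interval f (2 ^ n) (J n 0)
        \<and> (\<forall>k<2 ^ n. J n k = (f ^^ k) ` (J n 0))
        \<and> W \<subseteq> periodic_orbit_union f (2 ^ n) (J n 0)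
        \<and> (\<forall>K. periodic_interval f (2 ^ n) K \<and> K \<subseteq> J n 0
              \<and> W \<subseteq> periodic_orbit_union f (2 ^ n) K \<longrightarrow> K = J n 0)
        \<and> J (Suc n) 0 \<subseteq> J n 0)"

definition simple_set_of :: "(nat \<Rightarrow> nat \<Rightarrow> real set) \<Rightarrow> real set" where
  "simple_set_of J = (\<Inter>n. \<Union>k<2 ^ n. J n k)"

end

theory Submission
  imports Defs
begin

text \<open>
  Fix a non-degenerate interval \<open>U\<close> in the simple set and let \<open>K n 0\<close> be the level-\<open>n\<close> interval
  containing it, so that \<open>f\<close> permutes \<open>K n 0, \<dots>, K n (2 ^ n - 1)\<close> cyclically. For large \<open>n\<close> some
  interval \<open>K n (r + 1)\<close> of the cycle is short, so \<open>f\<close> on \<open>K n r\<close> can be replaced by a wild zigzag at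
  small cost. If the maps before that are slightly perturbed to remove flat pieces, one turn around
  the cycle maps each of three disjoint pieces of \<open>U\<close> onto \<open>K n 0\<close>: a 3-horseshoe seen at
  the scale of \<open>U\<close>.

  Block \<open>k\<close> of the sequence performs finitely many such turns at level \<open>\<nu> k\<close>, starting at time
  \<open>2 ^ (\<nu> k - 1)\<close>, and far more turns than all earlier blocks together; observed once per
  turn this has entropy at least \<open>ln 3\<close>. All maps respect the cycles of the current and lower
  levels, so the residue modulo \<open>2 ^ \<nu> k\<close> of (position in the cycle) - (time) is invariant from block
  \<open>k\<close> on. Block \<open>k\<close> moves only points with residue \<open>2 ^ (\<nu> k - 1)\<close>, so no point is moved by two
  blocks: every orbit is eventually an \<open>f\<close>-orbit, and an uncountable scrambled set would yield one
  for \<open>f\<close>.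
\<close>

section \<open>Perturbing one map on one interval\<close>

text \<open>Used to keep images of intervals from collapsing to a point. The intervals are treated
  one at a time: if the current map is constant on one of them, a low bump is added there, which
  leaves the intervals already treated non-flat.\<close>

lemma exists_nonflat_perturbation:
  fixes f :: "real \<Rightarrow> real"
  assumes f: "continuous_on unitI f" and ab: "{a..b} \<subseteq> unitI"
    and img: "f ` {a..b} = {c..d}" and cd: "c < d" and e: "e > 0" and fin: "finite \<B>"
    and B: "\<And>p q. (p, q) \<in> \<B> \<Longrightarrow> a \<le> p \<and> p < q \<and> q \<le> b"
  shows "\<exists>g. continuous_on unitI g \<and> (\<forall>x. x \<notin> {a..b} \<longrightarrow> g x = f x) \<and> g ` {a..b} = {c..d} \<and>
    (\<forall>x\<in>unitI. \<bar>g x - f x\<bar> < e) \<and> (\<forall>(p, q)\<in>\<B>. \<exists>x\<in>{p..q}. \<exists>y\<in>{p..q}. g x \<noteq> g y)"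
  using fin B e
proof (induction \<B> arbitrary: e rule: finite_induct)
  case empty
  show ?case using f img empty by (intro exI[of _ f]) auto
next
  case (insert P \<B>)
  obtain p q where P: "P = (p, q)" by fastforce
  have pq: "a \<le> p" "p < q" "q \<le> b" using insert.prems(1)[of p q] P by auto
  have "e / 2 > 0" using insert.prems by simp
  then have "\<exists>g. continuous_on unitI g \<and> (\<forall>x. x \<notin> {a..b} \<longrightarrow> g x = f x) \<and> g ` {a..b} = {c..d} \<and>
    (\<forall>x\<in>unitI. \<bar>g x - f x\<bar> < e / 2) \<and> (\<forall>(p, q)\<in>\<B>. \<exists>x\<in>{p..q}. \<exists>y\<in>{p..q}. g x \<noteq> g y)"
    using insert.prems(1) by (intro insert.IH) auto
  then obtain g where g0: "continuous_on unitI g \<and> (\<forall>x. x \<notin> {a..b} \<longrightarrow> g x = f x) \<and>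
    g ` {a..b} = {c..d} \<and> (\<forall>x\<in>unitI. \<bar>g x - f x\<bar> < e / 2) \<and>
    (\<forall>(p, q)\<in>\<B>. \<exists>x\<in>{p..q}. \<exists>y\<in>{p..q}. g x \<noteq> g y)" by blast
  have g: "continuous_on unitI g" "\<And>x. x \<notin> {a..b} \<Longrightarrow> g x = f x" "g ` {a..b} = {c..d}"
    "\<And>x. x \<in> unitI \<Longrightarrow> \<bar>g x - f x\<bar> < e / 2"
    "\<And>p q. (p, q) \<in> \<B> \<Longrightarrow> \<exists>x\<in>{p..q}. \<exists>y\<in>{p..q}. g x \<noteq> g y"
    using g0 by blast+
  show ?case
  proof (cases "\<exists>x\<in>{p..q}. \<exists>y\<in>{p..q}. g x \<noteq> g y")
    case True
    have "\<bar>g x - f x\<bar> < e" if "x \<in> unitI" for x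
      using g(4)[OF that] insert.prems(2) by linarith
    then show ?thesis using g True P by (intro exI[of _ g]) auto
  next
    case False
    define v where "v = g p"
    have flat: "g x = v" if "x \<in> {p..q}" for x
    proof -
      have "p \<in> {p..q}" using pq by simp
      then show ?thesis using False that unfolding v_def by blast
    qed
    have v: "v \<in> {c..d}" using g(3) pq unfolding v_def by force
    obtain s where s: "s \<noteq> 0" "\<bar>s\<bar> < e / 2" "v + s \<in> {c..d}"
    proof (cases "v < d")
      case True
      show ?thesis using True v insert.prems(2)
        by (intro that[of "min (e/4) (d - v)"]) (auto simp: min_def)
    next
      case False
      show ?thesis using False v insert.prems(2) cd
        by (intro that[of "- min (e/4) (d - c)"]) (auto simp: min_def)
    qed
    define w where "w x = max 0 ((x - p) * (q - x))" for x
    have w0: "w x = 0" if "x \<notin> {p<..<q}" for x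
    proof -
      have "(x - p) * (q - x) \<le> 0"
        using that pq by (cases "x \<le> p") (simp_all add: mult_nonneg_nonpos mult_nonpos_nonneg)
      then show ?thesis unfolding w_def by simp
    qed
    have w01: "0 \<le> w x \<and> w x \<le> 1" if "x \<in> unitI" for x
    proof (cases "x \<in> {p<..<q}")
      case True
      have "0 \<le> a" "b \<le> 1" using pq ab by auto
      then have "0 \<le> x - p" "x - p \<le> 1" "0 \<le> q - x" "q - x \<le> 1" using pq True by auto
      then have "(x - p) * (q - x) \<le> 1" by (simp add: mult_le_one)
      then show ?thesis unfolding w_def by auto
    qed (use w0 in auto)
    define h where "h x = g x + s * w x" for x
    have hoff: "h x = g x" if "x \<notin> {p<..<q}" for x unfolding h_def using w0[OF that] by simp
    have hv: "h x \<in> {c..d}" if "x \<in> {a..b}" for x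
    proof (cases "x \<in> {p<..<q}")
      case True
      then have "h x = v + s * w x" using flat[of x] unfolding h_def by simp
      \<comment> \<open>As \<open>w\<close> takes values in [0,1], the new value is a convex
        combination of two points of the image interval.\<close>
      also have "\<dots> = (1 - w x) * v + w x * (v + s)" by (simp add: algebra_simps)
      also have "\<dots> \<in> {c..d}"
      proof -
        have "0 \<le> w x" "w x \<le> 1" using w01[of x] that ab by auto
        then show ?thesis using convexD_alt[of "{c..d}" v "v + s" "w x"] v s(3) by simp
      qed
      finally show ?thesis .
    next
      case False
      then show ?thesis using hoff g(3) that by auto
    qed
    have "continuous_on unitI h" unfolding h_def w_def
      by (intro continuous_intros g(1))
    moreover have "h x = f x" if "x \<notin> {a..b}" for x using that g(2) hoff pq by auto
    moreover have "h ` {a..b} = {c..d}"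
    proof
      show "h ` {a..b} \<subseteq> {c..d}" using hv by auto
      show "{c..d} \<subseteq> h ` {a..b}"
      proof
        fix y assume "y \<in> {c..d}"
        then have "y \<in> g ` {a..b}" using g(3) by simp
        then obtain x where x: "x \<in> {a..b}" "y = g x" by blast
        show "y \<in> h ` {a..b}"
        proof (cases "x \<in> {p<..<q}")
          \<comment> \<open>The bump can only destroy the value \<open>v\<close>, and
            \<open>v\<close> is still taken at the endpoint \<open>p\<close>.\<close>
          case True
          then have "y = h p" using x flat[of x] hoff[of p] v_def by auto
          then show ?thesis using pq by auto
        next
          case False
          then have "y = h x" using x(2) hoff[of x] by simp
          then show ?thesis using x(1) by blast
        qed
      qed
    qed
    moreover have "\<bar>h x - f x\<bar> < e" if "x \<in> unitI" for x
    proof -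
      have "\<bar>s * w x\<bar> \<le> \<bar>s\<bar>" using w01[OF that] by (simp add: abs_mult mult_left_le)
      then show ?thesis using g(4)[OF that] s(2) unfolding h_def by linarith
    qed
    moreover have "\<exists>x\<in>{p'..q'}. \<exists>y\<in>{p'..q'}. h x \<noteq> h y" if p'q': "(p', q') \<in> insert P \<B>" for p' q'
    proof (cases "(p', q') = P")
      case True
      let ?z = "(p + q) / 2"
      have "(?z - p) * (q - ?z) > 0" using pq by (intro mult_pos_pos) auto
      then have "w ?z > 0" unfolding w_def by auto
      then have "h ?z \<noteq> g ?z" using s(1) unfolding h_def by simp
      moreover have "g ?z = v" using flat pq by auto
      moreover have "h p = v" using hoff[of p] v_def by simp
      ultimately show ?thesis using True P pq
        by (intro bexI[of _ ?z] bexI[of _ p]) auto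
    next
      case False
      then obtain x y where xy: "x \<in> {p'..q'}" "y \<in> {p'..q'}" "g x \<noteq> g y"
        using p'q' g(5)[of p' q'] by blast
      \<comment> \<open>A non-flat interval that meets (p,q) must also leave [p,q], so it contains
        \<open>p\<close> or \<open>q\<close>. There \<open>h\<close> equals \<open>v\<close>,
        whereas \<open>h y = g y\<close> differs from \<open>v\<close>.\<close>
      have mixed: ?thesis if xy: "x \<in> {p'..q'}" "y \<in> {p'..q'}" "g x \<noteq> g y" and x: "x \<in> {p<..<q}" for x y
      proof -
        have y: "y \<notin> {p..q}" using xy flat x by force
        have hy: "h y = g y" using y hoff by auto
        have gx: "g x = v" using flat x by auto
        have "h p = v" "h q = v" using hoff[of p] hoff[of q] flat[of q] pq v_def by auto
        moreover have "p \<in> {p'..q'} \<or> q \<in> {p'..q'}" using xy x y by auto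
        ultimately show ?thesis using hy gx xy by metis
      qed
      show ?thesis
      proof (cases "x \<in> {p<..<q} \<or> y \<in> {p<..<q}")
        case True
        then show ?thesis using mixed[OF xy] mixed[OF xy(2,1) xy(3)[symmetric]] by blast
      next
        case False
        then show ?thesis using xy hoff by metis
      qed
    qed
    ultimately show ?thesis by (intro exI[of _ h]) auto
  qed
qed

text \<open>On [a,b] the map is replaced by a cosine wave oscillating between \<open>c\<close> and
  \<open>d\<close>. Its phase is fitted to \<open>f a\<close> and \<open>f b\<close>, and its
  frequency is so high that every subinterval of length \<open>\<eta>\<close> contains a full
  period.\<close>

lemma exists_zigzag:
  fixes f :: "real \<Rightarrow> real"
  assumes f: "continuous_on unitI f" and ab: "a < b" "{a..b} \<subseteq> unitI"
    and img: "f ` {a..b} = {c..d}" and cd: "c < d" and eta: "\<eta> > 0"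
  shows "\<exists>g. continuous_on unitI g \<and> (\<forall>x. x \<notin> {a..b} \<longrightarrow> g x = f x) \<and> g ` {a..b} \<subseteq> {c..d} \<and>
    (\<forall>p q. a \<le> p \<and> p + \<eta> \<le> q \<and> q \<le> b \<longrightarrow> g ` {p..q} = {c..d})"
proof -
  define m where "m = (c + d) / 2"
  define r where "r = (d - c) / 2"
  have r: "r > 0" using cd unfolding r_def by simp
  have fab: "f a \<in> {c..d}" "f b \<in> {c..d}" using img ab by auto
  define \<alpha> where "\<alpha> = arccos ((f a - m) / r)"
  define \<beta> where "\<beta> = arccos ((f b - m) / r)"
  have rng: "-1 \<le> (y - m) / r \<and> (y - m) / r \<le> 1" if "y \<in> {c..d}" for y
    using that r unfolding m_def r_def by (auto simp: field_simps)
  have ca: "m + r * cos \<alpha> = f a" and cb: "m + r * cos \<beta> = f b"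
    unfolding \<alpha>_def \<beta>_def using rng[OF fab(1)] rng[OF fab(2)] r by auto
  have ar: "0 \<le> \<alpha>" "\<alpha> \<le> pi" "0 \<le> \<beta>" "\<beta> \<le> pi"
    unfolding \<alpha>_def \<beta>_def using rng[OF fab(1)] rng[OF fab(2)] arccos_lbound arccos_ubound by auto
  \<comment> \<open>The phase runs linearly from \<open>\<alpha>\<close> at \<open>a\<close> to
    \<open>\<beta> + 2 * pi * N\<close> at \<open>b\<close>. The extra 1 absorbs the possibly
    negative \<open>\<beta> - \<alpha>\<close>, so that the frequency \<open>k\<close> is at least
    \<open>2 * pi / \<eta>\<close>.\<close>
  obtain N :: nat where N: "real N > (b - a) / \<eta> + 1" using reals_Archimedean2 by blast
  define k where "k = (\<beta> + 2 * pi * real N - \<alpha>) / (b - a)"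
  have "\<beta> + 2 * pi * real N - \<alpha> \<ge> 2 * pi * (real N - 1)"
    using ar pi_ge_zero by (simp add: algebra_simps)
  moreover have "2 * pi * (real N - 1) \<ge> 2 * pi * ((b - a) / \<eta>)"
    using N pi_ge_zero by (intro mult_left_mono) auto
  ultimately have "\<beta> + 2 * pi * real N - \<alpha> \<ge> 2 * pi / \<eta> * (b - a)" by simp
  then have k: "k \<ge> 2 * pi / \<eta>" unfolding k_def using ab(1) by (simp add: pos_le_divide_eq)
  have kpos: "k > 0" using k eta pi_gt_zero by (smt (verit) divide_pos_pos)
  define z where "z x = m + r * cos (\<alpha> + k * (x - a))" for x
  have za: "z a = f a" unfolding z_def using ca by simp
  have "cos (\<alpha> + k * (b - a)) = cos (\<beta> + 2 * pi * real N)"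
    unfolding k_def using ab(1) by simp
  also have "\<dots> = cos \<beta>"
    using cos_int_2pin[of "int N"] sin_int_2pin[of "int N"] by (simp add: cos_add)
  finally have zb: "z b = f b" unfolding z_def using cb by simp
  have zr: "z x \<in> {c..d}" for x
  proof -
    have "\<bar>r * cos (\<alpha> + k * (x - a))\<bar> \<le> r" using r by (simp add: abs_mult mult_left_le)
    then have "m - r \<le> z x" "z x \<le> m + r" unfolding z_def by linarith+
    then show ?thesis unfolding m_def r_def by (auto simp: field_simps)
  qed
  define g where "g x = (if x \<in> {a..b} then z x else f x)" for x
  have "continuous_on unitI g"
  proof -
    have U: "unitI = {0..a} \<union> ({a..b} \<union> {b..1})" using ab by auto
    have 1: "continuous_on {a..b} g"
    proof -
      have "continuous_on {a..b} z" unfolding z_def by (intro continuous_intros)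
      then show ?thesis by (rule continuous_on_eq) (simp add: g_def)
    qed
    have 2: "continuous_on {0..a} g"
    proof -
      have "continuous_on {0..a} f" using f ab by (auto intro: continuous_on_subset)
      then show ?thesis by (rule continuous_on_eq) (use za in \<open>auto simp: g_def\<close>)
    qed
    have 3: "continuous_on {b..1} g"
    proof -
      have "continuous_on {b..1} f" using f ab by (auto intro: continuous_on_subset)
      then show ?thesis by (rule continuous_on_eq) (use zb in \<open>auto simp: g_def\<close>)
    qed
    show ?thesis unfolding U using 1 2 3 by (intro continuous_on_closed_Un) auto
  qed
  moreover have "g ` {p..q} = {c..d}" if pq: "a \<le> p" "p + \<eta> \<le> q" "q \<le> b" for p q
  proof
    show "g ` {p..q} \<subseteq> {c..d}" using zr pq unfolding g_def by auto
    show "{c..d} \<subseteq> g ` {p..q}"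
    proof
      fix y assume y: "y \<in> {c..d}"
      define t where "t = arccos ((y - m) / r)"
      have t: "m + r * cos t = y" unfolding t_def using rng[OF y] r by simp
      \<comment> \<open>Picks the first phase congruent to \<open>t\<close> at or after the phase of
        \<open>p\<close>. It comes less than one period later, hence not after the phase of
        \<open>q\<close>.\<close>
      define j where "j = \<lceil>(\<alpha> + k * (p - a) - t) / (2 * pi)\<rceil>"
      define x where "x = a + (t + 2 * pi * of_int j - \<alpha>) / k"
      have "(\<alpha> + k * (p - a) - t) / (2 * pi) \<le> of_int j"
        "of_int j < (\<alpha> + k * (p - a) - t) / (2 * pi) + 1" unfolding j_def by linarith+
      then have j: "\<alpha> + k * (p - a) \<le> t + 2 * pi * of_int j"
        "t + 2 * pi * of_int j < \<alpha> + k * (p - a) + 2 * pi"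
        using pi_gt_zero by (simp_all add: field_simps)
      have kx: "\<alpha> + k * (x - a) = t + 2 * pi * of_int j"
        unfolding x_def using kpos by (simp add: field_simps)
      have "k * \<eta> \<ge> 2 * pi" using k eta by (simp add: field_simps)
      moreover have "k * \<eta> \<le> k * (q - p)" using pq kpos by (intro mult_left_mono) auto
      ultimately have "k * (p - a) \<le> k * (x - a)" "k * (x - a) \<le> k * (q - a)"
        using j kx by (simp_all add: algebra_simps)
      then have x: "x \<in> {p..q}" using kpos by auto
      have "cos (t + 2 * pi * of_int j) = cos t"
        using cos_int_2pin[of j] sin_int_2pin[of j] by (simp add: cos_add)
      then have "z x = y" unfolding z_def kx using t by simp
      then show "y \<in> g ` {p..q}" using x pq unfolding g_def by force
    qed
  qed
  ultimately show ?thesis using zr by (intro exI[of _ g]) (auto simp: g_def)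
qed

section \<open>Composing perturbations around a cycle of intervals\<close>

lemma nds_iter_cong:
  assumes "\<And>i. i < n \<Longrightarrow> g (Suc i) = h (Suc i)"
  shows "nds_iter g n = nds_iter h n"
  using assms by (induction n) auto

lemma nds_iter_add: "nds_iter fs (n + i) x = nds_iter (\<lambda>j. fs (n + j)) i (nds_iter fs n x)"
  by (induction i) auto

lemma image_nds_iter_Suc: "nds_iter h (Suc n) ` X = h (Suc n) ` (nds_iter h n ` X)"
  by (simp add: image_comp)

lemma image_nds_iter:
  assumes "\<And>i. i < n \<Longrightarrow> h (Suc i) ` K i = K (Suc i)"
  shows "nds_iter h n ` K 0 = K n"
  using assms
proof (induction n)
  case (Suc n)
  show ?case unfolding image_nds_iter_Suc using Suc by simp
qed simp

text \<open>The admissible modifications: preserving the image of the whole interval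
  \<open>K\<close> is what keeps a cycle of intervals intact and the maps surjective.\<close>

definition small_change ::
    "(real \<Rightarrow> real) \<Rightarrow> real \<Rightarrow> real set \<Rightarrow> real set \<Rightarrow> (real \<Rightarrow> real) \<Rightarrow> bool" where
  "small_change f e K L g \<longleftrightarrow> continuous_on unitI g \<and> (\<forall>x. x \<notin> K \<longrightarrow> g x = f x) \<and> g ` K = L \<and>
     (\<forall>x\<in>unitI. \<bar>g x - f x\<bar> < e)"

lemma small_change_refl:
  "continuous_on unitI f \<Longrightarrow> e > 0 \<Longrightarrow> small_change f e K (f ` K) f"
  by (auto simp: small_change_def)

text \<open>At each step the current images of the given intervals form a finite family of
  non-degenerate intervals. Making the next map non-constant on each of them keeps their images
  non-degenerate, and continuity keeps them intervals.\<close>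

lemma exists_nonflat_chain:
  fixes f :: "real \<Rightarrow> real" and a b :: "nat \<Rightarrow> real"
  assumes f: "continuous_on unitI f" and ab: "\<And>i. a i < b i" "\<And>i. {a i..b i} \<subseteq> unitI"
    and img: "\<And>i. f ` {a i..b i} = {a (Suc i)..b (Suc i)}" and e: "e > 0" and fin: "finite \<B>"
    and B: "\<And>p q. (p, q) \<in> \<B> \<Longrightarrow> a 0 \<le> p \<and> p < q \<and> q \<le> b 0"
  shows "\<exists>h. (\<forall>i<r. small_change f e {a i..b i} {a (Suc i)..b (Suc i)} (h (Suc i))) \<and>
    (\<forall>(p, q)\<in>\<B>. \<exists>p' q'. p' < q' \<and> a r \<le> p' \<and> q' \<le> b r \<and> nds_iter h r ` {p..q} = {p'..q'})"
proof (induction r)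
  case 0
  show ?case using B by (fastforce intro!: exI[of _ "\<lambda>_. f"])
next
  case (Suc r)
  then obtain h where h: "\<And>i. i < r \<Longrightarrow> small_change f e {a i..b i} {a (Suc i)..b (Suc i)} (h (Suc i))"
    "\<forall>(p, q)\<in>\<B>. \<exists>p' q'. p' < q' \<and> a r \<le> p' \<and> q' \<le> b r \<and> nds_iter h r ` {p..q} = {p'..q'}"
    by blast
  from h(2) have "\<forall>P\<in>\<B>. \<exists>P'. fst P' < snd P' \<and> a r \<le> fst P' \<and> snd P' \<le> b r \<and>
      nds_iter h r ` {fst P..snd P} = {fst P'..snd P'}" by fastforce
  then obtain F where F: "\<And>P. P \<in> \<B> \<Longrightarrow> fst (F P) < snd (F P) \<and> a r \<le> fst (F P) \<and> snd (F P) \<le> b r \<and>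
      nds_iter h r ` {fst P..snd P} = {fst (F P)..snd (F P)}" by metis
  have "\<exists>g. continuous_on unitI g \<and> (\<forall>x. x \<notin> {a r..b r} \<longrightarrow> g x = f x) \<and>
      g ` {a r..b r} = {a (Suc r)..b (Suc r)} \<and> (\<forall>x\<in>unitI. \<bar>g x - f x\<bar> < e) \<and>
      (\<forall>(p, q)\<in>F ` \<B>. \<exists>x\<in>{p..q}. \<exists>y\<in>{p..q}. g x \<noteq> g y)"
  proof (rule exists_nonflat_perturbation[OF f ab(2) img ab(1) e])
    show "finite (F ` \<B>)" using fin by simp
    show "a r \<le> p \<and> p < q \<and> q \<le> b r" if "(p, q) \<in> F ` \<B>" for p q
      using that F by (metis fst_conv imageE snd_conv)
  qed
  then obtain g where "continuous_on unitI g \<and> (\<forall>x. x \<notin> {a r..b r} \<longrightarrow> g x = f x) \<and>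
      g ` {a r..b r} = {a (Suc r)..b (Suc r)} \<and> (\<forall>x\<in>unitI. \<bar>g x - f x\<bar> < e) \<and>
      (\<forall>(p, q)\<in>F ` \<B>. \<exists>x\<in>{p..q}. \<exists>y\<in>{p..q}. g x \<noteq> g y)" by blast
  then have g: "small_change f e {a r..b r} {a (Suc r)..b (Suc r)} g"
    "\<And>p q. (p, q) \<in> F ` \<B> \<Longrightarrow> \<exists>x\<in>{p..q}. \<exists>y\<in>{p..q}. g x \<noteq> g y"
    unfolding small_change_def by blast+
  define h' where "h' = h(Suc r := g)"
  have it: "nds_iter h' r = nds_iter h r" by (rule nds_iter_cong) (simp add: h'_def)
  have 1: "small_change f e {a i..b i} {a (Suc i)..b (Suc i)} (h' (Suc i))" if "i < Suc r" for i
    using that g(1) h(1) unfolding h'_def by (cases "i = r") auto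
  have 2: "\<exists>p' q'. p' < q' \<and> a (Suc r) \<le> p' \<and> q' \<le> b (Suc r) \<and> nds_iter h' (Suc r) ` {p..q} = {p'..q'}"
    if P: "(p, q) \<in> \<B>" for p q
  proof -
    define p1 q1 where "p1 = fst (F (p, q))" and "q1 = snd (F (p, q))"
    have pq1: "p1 < q1" "a r \<le> p1" "q1 \<le> b r" "nds_iter h r ` {p..q} = {p1..q1}"
      using F[OF P] unfolding p1_def q1_def by auto
    have sub: "{p1..q1} \<subseteq> {a r..b r}" using pq1 by auto
    have "nds_iter h' (Suc r) ` {p..q} = g ` {p1..q1}"
      unfolding image_nds_iter_Suc it pq1(4) by (simp add: h'_def)
    moreover have "continuous_on {p1..q1} g"
      using g(1) sub ab(2)[of r] unfolding small_change_def by (meson continuous_on_subset)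
    then obtain p' q' where p'q': "g ` {p1..q1} = {p'..q'}" "p' \<le> q'"
      using continuous_image_closed_interval[of p1 q1 g] pq1(1) by auto
    moreover have "p' \<noteq> q'"
    proof
      assume "p' = q'"
      then have "g ` {p1..q1} = {p'}" using p'q'(1) by simp
      moreover have "(p1, q1) \<in> F ` \<B>" using P unfolding p1_def q1_def by (metis image_eqI prod.collapse)
      ultimately show False using g(2)[of p1 q1] by (metis imageI singletonD)
    qed
    moreover have "{p'..q'} \<subseteq> {a (Suc r)..b (Suc r)}"
      using p'q'(1) sub g(1) unfolding small_change_def by blast
    ultimately show ?thesis by (intro exI[of _ p'] exI[of _ q']) auto
  qed
  show ?case using 1 2 by (intro exI[of _ h']) auto
qed

text \<open>Up to step \<open>r\<close> the non-flat chain keeps the pieces non-degenerate. A zigzag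
  on interval \<open>r\<close> then stretches each of them over interval \<open>r + 1\<close>, at a
  cost below \<open>e\<close> because that interval is short. From there \<open>f\<close> itself
  carries full intervals onto full intervals.\<close>

lemma exists_covering_loop:
  fixes f :: "real \<Rightarrow> real" and a b :: "nat \<Rightarrow> real"
  assumes f: "continuous_on unitI f" and ab: "\<And>i. a i < b i" "\<And>i. {a i..b i} \<subseteq> unitI"
    and img: "\<And>i. f ` {a i..b i} = {a (Suc i)..b (Suc i)}" and e: "e > 0" and fin: "finite \<B>"
    and B: "\<And>p q. (p, q) \<in> \<B> \<Longrightarrow> a 0 \<le> p \<and> p < q \<and> q \<le> b 0"
    and r: "r < m" and small: "b (Suc r) - a (Suc r) < e"
  shows "\<exists>h. (\<forall>i. small_change f e {a i..b i} {a (Suc i)..b (Suc i)} (h (Suc i))) \<and>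
    (\<forall>(p, q)\<in>\<B>. nds_iter h m ` {p..q} = {a m..b m})"
proof -
  obtain h where h: "\<And>i. i < r \<Longrightarrow> small_change f e {a i..b i} {a (Suc i)..b (Suc i)} (h (Suc i))"
    "\<forall>(p, q)\<in>\<B>. \<exists>p' q'. p' < q' \<and> a r \<le> p' \<and> q' \<le> b r \<and> nds_iter h r ` {p..q} = {p'..q'}"
    using exists_nonflat_chain[where r = r, OF f ab img e fin B] by blast
  from h(2) have "\<forall>P\<in>\<B>. \<exists>P'. fst P' < snd P' \<and> a r \<le> fst P' \<and> snd P' \<le> b r \<and>
      nds_iter h r ` {fst P..snd P} = {fst P'..snd P'}" by fastforce
  then obtain F where F: "\<And>P. P \<in> \<B> \<Longrightarrow> fst (F P) < snd (F P) \<and> a r \<le> fst (F P) \<and> snd (F P) \<le> b r \<and>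
      nds_iter h r ` {fst P..snd P} = {fst (F P)..snd (F P)}" by metis
  \<comment> \<open>The shortest image piece at time \<open>r\<close>. Including the length of the
    whole interval makes the set non-empty and the zigzag onto.\<close>
  define \<eta> where "\<eta> = Min (insert (b r - a r) ((\<lambda>P. snd (F P) - fst (F P)) ` \<B>))"
  have \<eta>: "\<eta> > 0" unfolding \<eta>_def using fin F ab(1)[of r] by (subst Min_gr_iff) auto
  have \<eta>r: "\<eta> \<le> b r - a r" unfolding \<eta>_def using fin by (intro Min_le) auto
  have \<eta>F: "\<eta> \<le> snd (F P) - fst (F P)" if "P \<in> \<B>" for P
    unfolding \<eta>_def using fin that by (intro Min_le) auto
  obtain g where g: "continuous_on unitI g" "\<And>x. x \<notin> {a r..b r} \<Longrightarrow> g x = f x"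
    "\<And>p q. a r \<le> p \<and> p + \<eta> \<le> q \<and> q \<le> b r \<Longrightarrow> g ` {p..q} = {a (Suc r)..b (Suc r)}"
    using exists_zigzag[OF f ab(1) ab(2) img ab(1) \<eta>, of r] by blast
  have gimg: "g ` {a r..b r} = {a (Suc r)..b (Suc r)}" using g(3)[of "a r" "b r"] \<eta>r by simp
  have "\<bar>g x - f x\<bar> < e" for x
  proof (cases "x \<in> {a r..b r}")
    case True
    then have "g x \<in> {a (Suc r)..b (Suc r)}" "f x \<in> {a (Suc r)..b (Suc r)}"
      using gimg img[of r] by blast+
    then show ?thesis using small by auto
  qed (use g(2) e in auto)
  with g gimg have sg: "small_change f e {a r..b r} {a (Suc r)..b (Suc r)} g"
    unfolding small_change_def by blast
  define h' where "h' i = (if i \<le> r then h i else if i = Suc r then g else f)" for i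
  have it: "nds_iter h' r = nds_iter h r" by (rule nds_iter_cong) (simp add: h'_def)
  have 1: "small_change f e {a i..b i} {a (Suc i)..b (Suc i)} (h' (Suc i))" for i
  proof (cases i r rule: linorder_cases)
    case greater
    then show ?thesis using small_change_refl[OF f e, of "{a i..b i}"] img[of i] by (simp add: h'_def)
  qed (use h(1) sg in \<open>auto simp: h'_def\<close>)
  have 2: "nds_iter h' m ` {p..q} = {a m..b m}" if P: "(p, q) \<in> \<B>" for p q
  proof -
    have "g ` {fst (F (p, q))..snd (F (p, q))} = {a (Suc r)..b (Suc r)}"
      using F[OF P] \<eta>F[OF P] by (intro g(3)) auto
    then have s: "nds_iter h' (Suc r) ` {p..q} = {a (Suc r)..b (Suc r)}"
      unfolding image_nds_iter_Suc it using F[OF P] by (simp add: h'_def)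
    have m: "m = Suc r + (m - Suc r)" using r by simp
    have "nds_iter h' m ` {p..q} = nds_iter (\<lambda>j. h' (Suc r + j)) (m - Suc r) ` (nds_iter h' (Suc r) ` {p..q})"
      unfolding image_image by (subst m) (rule image_cong[OF refl nds_iter_add])
    also have "\<dots> = {a m..b m}"
      unfolding s
      using image_nds_iter[of "m - Suc r" "\<lambda>j. h' (Suc r + j)" "\<lambda>j. {a (Suc r + j)..b (Suc r + j)}"]
        1 r by (simp add: small_change_def)
    finally show ?thesis .
  qed
  have "\<forall>(p, q)\<in>\<B>. nds_iter h' m ` {p..q} = {a m..b m}"
  proof
    fix P assume "P \<in> \<B>"
    then show "case P of (p, q) \<Rightarrow> nds_iter h' m ` {p..q} = {a m..b m}" using 2 by (cases P) simp
  qed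
  with 1 show ?thesis by blast
qed

section \<open>Separated sets, itineraries and scrambled sets\<close>

text \<open>\<open>Sup\<close> on \<open>nat\<close> is an upper bound only for bounded sets.
  Boundedness comes from rounding orbits to cells of length \<open>e\<close>: points of a separated
  set have distinct codes, and there are finitely many codes.\<close>

lemma card_le_sep_num:
  assumes E: "finite E" "separated fs A n e E" and e: "e > 0"
    and inv: "\<And>j x. x \<in> unitI \<Longrightarrow> nds_iter fs j x \<in> unitI"
  shows "card E \<le> sep_num fs A n e"
proof -
  let ?T = "PiE {..<n} (\<lambda>_. {0..\<lfloor>1 / e\<rfloor>})"
  have fin: "finite ?T" by (intro finite_PiE) auto
  have "card E' \<le> card ?T" if E': "separated fs A n e E'" for E'
  proof (rule card_inj_on_le[OF _ _ fin])
    let ?\<phi> = "\<lambda>x. \<lambda>j\<in>{..<n}. \<lfloor>nds_iter fs (A j) x / e\<rfloor>"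
    show "?\<phi> ` E' \<subseteq> ?T"
    proof -
      have "\<lfloor>nds_iter fs (A j) x / e\<rfloor> \<in> {0..\<lfloor>1 / e\<rfloor>}" if "x \<in> E'" for x j
      proof -
        have "x \<in> unitI" using that E' unfolding separated_def by blast
        then have "nds_iter fs (A j) x \<in> unitI" by (rule inv)
        then have "0 \<le> nds_iter fs (A j) x / e" "nds_iter fs (A j) x / e \<le> 1 / e"
          using e by (auto intro: divide_right_mono)
        then show ?thesis by (simp add: floor_mono)
      qed
      then show ?thesis by (auto split: if_splits)
    qed
    show "inj_on ?\<phi> E'"
    proof (rule inj_onI, rule ccontr)
      fix x y assume xy: "x \<in> E'" "y \<in> E'" "?\<phi> x = ?\<phi> y" "x \<noteq> y"
      then obtain j where j: "j < n" "\<bar>nds_iter fs (A j) x - nds_iter fs (A j) y\<bar> > e"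
        using E' unfolding separated_def by blast
      have "\<lfloor>nds_iter fs (A j) x / e\<rfloor> = \<lfloor>nds_iter fs (A j) y / e\<rfloor>"
        using fun_cong[OF xy(3), of j] j(1) by simp
      then have "\<bar>nds_iter fs (A j) x / e - nds_iter fs (A j) y / e\<bar> < 1" by linarith
      then have "\<bar>nds_iter fs (A j) x - nds_iter fs (A j) y\<bar> / e < 1"
        using e by (simp add: diff_divide_distrib[symmetric] abs_divide)
      then show False using j(2) e by (simp add: field_simps)
    qed
  qed
  then have "bdd_above {card E | E. finite E \<and> separated fs A n e E}" by (intro bdd_aboveI) auto
  then show ?thesis unfolding sep_num_def using E by (intro cSup_upper) auto
qed

text \<open>Induction from the end of the word: a point realising the shifted word lies in
  \<open>L\<close>, so it has a preimage in the piece of the first letter.\<close>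

lemma covering_itinerary:
  assumes "\<And>j. j < (3::nat) \<Longrightarrow> A j \<subseteq> L \<and> \<Phi> ` A j = L" and "L \<noteq> {}" and "\<And>l. w l < 3"
  shows "\<exists>x\<in>L. \<forall>l<N. (\<Phi> ^^ l) x \<in> A (w l)"
  using assms(3)
proof (induction N arbitrary: w)
  case 0
  then show ?case using assms(2) by auto
next
  case (Suc N)
  obtain y where y: "y \<in> L" "\<And>l. l < N \<Longrightarrow> (\<Phi> ^^ l) y \<in> A (w (Suc l))"
    using Suc.IH[of "\<lambda>l. w (Suc l)"] Suc.prems by blast
  obtain x where x: "x \<in> A (w 0)" "\<Phi> x = y" using y(1) assms(1)[of "w 0"] Suc.prems[of 0] by blast
  have "(\<Phi> ^^ l) x \<in> A (w l)" if "l < Suc N" for l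
    using that x y by (cases l) (auto simp: funpow_Suc_right simp del: funpow.simps(2))
  then show ?case using x assms(1)[of "w 0"] Suc.prems[of 0] by blast
qed

text \<open>If every orbit is eventually an orbit of \<open>f\<close>, an uncountable scrambled set has an
  uncountable part on which this happens from a common time on, and the states at that time
  form a scrambled set of \<open>f\<close>.\<close>
lemma not_li_yorke_chaotic_if_eventually_autonomous:
  assumes notLY: "\<not> li_yorke_chaotic (\<lambda>_. f)"
    and inv: "\<And>j x. x \<in> unitI \<Longrightarrow> nds_iter fs j x \<in> unitI"
    and ev: "\<And>x. x \<in> unitI \<Longrightarrow> \<exists>T. \<forall>t\<ge>T. fs (Suc t) (nds_iter fs t x) = f (nds_iter fs t x)"
  shows "\<not> li_yorke_chaotic fs"
proof
  assume "li_yorke_chaotic fs"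
  then obtain S where S: "S \<subseteq> unitI" "uncountable S"
    "\<And>x y. x \<in> S \<Longrightarrow> y \<in> S \<Longrightarrow> x \<noteq> y \<Longrightarrow> li_yorke_pair fs x y"
    unfolding li_yorke_chaotic_def by blast
  define R where "R T = {x \<in> S. \<forall>t\<ge>T. fs (Suc t) (nds_iter fs t x) = f (nds_iter fs t x)}" for T
  have "S = (\<Union>T. R T)" using ev S(1) unfolding R_def by blast
  then obtain T where T: "uncountable (R T)" using S(2) by (metis countable_UN uncountable_def countableI_type)
  let ?F = "nds_iter fs T"
  have shift: "nds_iter fs (n + T) x = nds_iter (\<lambda>_. f) n (?F x)" if "x \<in> R T" for x n
  proof (induction n)
    case (Suc n)
    have "fs (Suc (n + T)) (nds_iter fs (n + T) x) = f (nds_iter fs (n + T) x)"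
      using that unfolding R_def by simp
    then show ?case using Suc by simp
  qed simp
  have pair: "li_yorke_pair (\<lambda>_. f) (?F x) (?F y)" if xy: "x \<in> R T" "y \<in> R T" "x \<noteq> y" for x y
  proof -
    let ?d = "\<lambda>n. ereal \<bar>nds_iter fs n x - nds_iter fs n y\<bar>"
    let ?d' = "\<lambda>n. ereal \<bar>nds_iter (\<lambda>_. f) n (?F x) - nds_iter (\<lambda>_. f) n (?F y)\<bar>"
    have "li_yorke_pair fs x y" using xy S(3) unfolding R_def by blast
    then have "limsup ?d > 0" "liminf ?d = 0" unfolding li_yorke_pair_def by auto
    moreover have d: "?d' = (\<lambda>n. ?d (n + T))" using shift xy by simp
    ultimately have "limsup ?d' > 0" "liminf ?d' = 0"
      using limsup_shift_k[of ?d T] liminf_shift_k[of ?d T] by auto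
    moreover have "?F x \<noteq> ?F y"
    proof
      assume "?F x = ?F y"
      then have "limsup ?d' = 0" by (simp add: Limsup_const zero_ereal_def)
      with \<open>limsup ?d' > 0\<close> show False by simp
    qed
    ultimately show ?thesis unfolding li_yorke_pair_def by auto
  qed
  \<comment> \<open>Members of a Li-Yorke pair are distinct, so passing to the states at time
    \<open>T\<close> preserves uncountability.\<close>
  then have "inj_on ?F (R T)" unfolding inj_on_def li_yorke_pair_def by blast
  then have "uncountable (?F ` R T)" using T countable_image_inj_on by blast
  moreover have "?F ` R T \<subseteq> unitI" using inv S(1) unfolding R_def by blast
  moreover have "\<forall>x\<in>?F ` R T. \<forall>y\<in>?F ` R T. x \<noteq> y \<longrightarrow> li_yorke_pair (\<lambda>_. f) x y"
    using pair by blast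
  ultimately show False using notLY unfolding li_yorke_chaotic_def by blast
qed

section \<open>A three-horseshoe in nested cycles of intervals\<close>

lemma image_eq_of_small_change:
  assumes "small_change f e K (f ` K) g" "K \<subseteq> X"
  shows "g ` X = f ` X"
proof -
  have "g ` (X - K) = f ` (X - K)" using assms(1) unfolding small_change_def by (intro image_cong) auto
  moreover have "g ` K = f ` K" using assms(1) unfolding small_change_def by blast
  moreover have "X = (X - K) \<union> K" using assms(2) by blast
  ultimately show ?thesis by (metis image_Un)
qed

text \<open>For \<open>j\<close> = 0, 1, 2 these are the first, third and fifth of five equal parts
  of [u,v]; the omitted fifths separate them.\<close>

definition odd_fifth :: "real \<Rightarrow> real \<Rightarrow> nat \<Rightarrow> real set" where
  "odd_fifth u v j = {u + 2 * real j * ((v - u) / 5)..u + (2 * real j + 1) * ((v - u) / 5)}"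

lemma odd_fifth_subset: "u < v \<Longrightarrow> j < 3 \<Longrightarrow> odd_fifth u v j \<subseteq> {u..v}"
proof -
  assume uv: "u < v" and "j < 3"
  then consider "j = 0" | "j = 1" | "j = 2" by linarith
  then show ?thesis unfolding odd_fifth_def using uv by cases (auto simp: field_simps)
qed

lemma odd_fifth_separated:
  assumes "u < v" "x \<in> odd_fifth u v i" "y \<in> odd_fifth u v j" "i \<noteq> j"
  shows "\<bar>x - y\<bar> > (v - u) / 10"
proof -
  define w where "w = (v - u) / 5"
  have w: "w > 0" using assms(1) unfolding w_def by simp
  have *: "y - x \<ge> w" if "x \<in> odd_fifth u v i" "y \<in> odd_fifth u v j" "i < j" for x y i j
  proof -
    have "real i + 1 \<le> real j" using that(3) by linarith
    then have "(2 * real i + 2) * w \<le> 2 * real j * w" using w by (intro mult_right_mono) auto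
    then show ?thesis using that(1,2) unfolding odd_fifth_def w_def[symmetric] by (auto simp: algebra_simps)
  qed
  \<comment> \<open>The gap only yields a weak inequality with a fifth; claiming a tenth makes it
    strict, as \<open>separated\<close> demands.\<close>
  have "\<bar>x - y\<bar> \<ge> w" using *[OF assms(2,3)] *[OF assms(3,2)] assms(4) by (cases "i < j") auto
  then show ?thesis using w unfolding w_def by simp
qed

text \<open>Indices run over all naturals and are read modulo \<open>2 ^ n\<close>, which avoids
  wrap-around. Every cycle is numbered from the interval containing [u,v], so equal indices are
  nested across levels.\<close>

locale nested_cycles =
  fixes f :: "real \<Rightarrow> real" and a b :: "nat \<Rightarrow> nat \<Rightarrow> real" and u v :: real
  assumes cont: "continuous_on unitI f"
    and surj: "f ` unitI = unitI"
    and ab: "a n i < b n i"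
    and sub: "{a n i..b n i} \<subseteq> unitI"
    and img: "f ` {a n i..b n i} = {a n (Suc i)..b n (Suc i)}"
    and disj: "{a n i..b n i} \<inter> {a n j..b n j} \<noteq> {} \<Longrightarrow> i mod 2 ^ n = j mod 2 ^ n"
    and per: "i mod 2 ^ n = j mod 2 ^ n \<Longrightarrow> {a n i..b n i} = {a n j..b n j}"
    and nest: "{a (Suc n) i..b (Suc n) i} \<subseteq> {a n i..b n i}"
    and uv: "u < v" and uv_sub: "{u..v} \<subseteq> {a n 0..b n 0}"
begin

abbreviation K where "K n i \<equiv> {a n i..b n i}"

lemma K_antimono: "n \<le> n' \<Longrightarrow> K n' i \<subseteq> K n i"
  by (rule lift_Suc_antimono_le[of "\<lambda>n. K n i"]) (rule nest)

text \<open>Only boundedly many disjoint intervals of length at least \<open>e\<close> fit into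
  [0,1], while the cycle has \<open>2 ^ n - 1\<close> members besides interval 0. The short interval
  is written as a successor because the zigzag is placed on its predecessor.\<close>

lemma exists_short_interval:
  assumes e: "e > 0"
  shows "\<exists>n0. \<forall>n\<ge>n0. \<exists>r. Suc r < 2 ^ n \<and> b n (Suc r) - a n (Suc r) < e"
proof -
  obtain n0 :: nat where n0: "1 / e + 2 < real n0" using reals_Archimedean2 by blast
  have "\<exists>r. Suc r < 2 ^ n \<and> b n (Suc r) - a n (Suc r) < e" if n: "n \<ge> n0" for n
  proof (rule ccontr)
    assume neg: "\<not> ?thesis"
    have long: "b n i - a n i \<ge> e" if i: "i \<in> {1..<2 ^ n}" for i
    proof -
      obtain r where r: "i = Suc r" using i by (cases i) auto
      then have "Suc r < 2 ^ n" using i by simp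
      then show ?thesis using neg r by (metis not_less)
    qed
    \<comment> \<open>Two long intervals whose left endpoints fall into the same cell of length
      \<open>e\<close> would intersect.\<close>
    let ?\<phi> = "\<lambda>i. \<lfloor>a n i / e\<rfloor>"
    have close: "i = j" if "i \<in> {1..<2 ^ n}" "j \<in> {1..<2 ^ n}" "?\<phi> i = ?\<phi> j" "a n i \<le> a n j" for i j
    proof -
      have "a n j / e - a n i / e < 1" using that(3) by linarith
      then have "a n j < a n i + e" using e by (simp add: field_simps)
      then have "a n j \<in> K n i \<inter> K n j" using that(4) long[OF that(1)] ab[of n j] by auto
      then have "i mod 2 ^ n = j mod 2 ^ n" using disj by blast
      then show ?thesis using that(1,2) by simp
    qed
    have "inj_on ?\<phi> {1..<2 ^ n}"
      using close by (intro inj_onI) (metis linear)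
    moreover have "?\<phi> ` {1..<2 ^ n} \<subseteq> {0..\<lfloor>1 / e\<rfloor>}"
    proof -
      have "0 \<le> a n i \<and> a n i \<le> 1" for i using sub[of n i] ab[of n i] by auto
      then have "0 \<le> a n i / e \<and> a n i / e \<le> 1 / e" for i using e by (simp add: divide_right_mono)
      then have "0 \<le> \<lfloor>a n i / e\<rfloor> \<and> \<lfloor>a n i / e\<rfloor> \<le> \<lfloor>1 / e\<rfloor>" for i by (simp add: floor_mono)
      then show ?thesis by auto
    qed
    ultimately have "card {1..<(2::nat) ^ n} \<le> card {0..\<lfloor>1 / e\<rfloor>}" by (intro card_inj_on_le) auto
    then have "2 ^ n - 1 \<le> nat (\<lfloor>1 / e\<rfloor> + 1)" by simp
    moreover have "n < 2 ^ n" by simp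
    ultimately have "n \<le> nat (\<lfloor>1 / e\<rfloor> + 1)" by linarith
    moreover have "\<lfloor>1 / e\<rfloor> \<ge> 0" using e by simp
    ultimately have "real n \<le> of_int \<lfloor>1 / e\<rfloor> + 1" by linarith
    also have "\<dots> \<le> 1 / e + 1" by simp
    finally show False using n0 n by linarith
  qed
  then show ?thesis by blast
qed

lemma exists_loop:
  assumes e: "e > 0"
  shows "\<exists>n0. \<forall>n\<ge>n0. \<exists>h. (\<forall>i. small_change f e (K n i) (K n (Suc i)) (h (Suc i))) \<and>
    (\<forall>j<3. nds_iter h (2 ^ n) ` odd_fifth u v j = K n 0)"
proof -
  obtain n0 where n0: "\<And>n. n \<ge> n0 \<Longrightarrow> \<exists>r. Suc r < 2 ^ n \<and> b n (Suc r) - a n (Suc r) < e"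
    using exists_short_interval[OF e] by blast
  have "\<exists>h. (\<forall>i. small_change f e (K n i) (K n (Suc i)) (h (Suc i))) \<and>
    (\<forall>j<3. nds_iter h (2 ^ n) ` odd_fifth u v j = K n 0)" if "n \<ge> n0" for n
  proof -
    obtain r where r: "Suc r < 2 ^ n" "b n (Suc r) - a n (Suc r) < e" using n0 \<open>n \<ge> n0\<close> by blast
    define lo where "lo j = u + 2 * real j * ((v - u) / 5)" for j :: nat
    define hi where "hi j = u + (2 * real j + 1) * ((v - u) / 5)" for j :: nat
    have th: "odd_fifth u v j = {lo j..hi j}" for j unfolding odd_fifth_def lo_def hi_def by simp
    have lohi: "lo j < hi j" for j
    proof -
      have "hi j = lo j + (v - u) / 5" unfolding lo_def hi_def by (simp add: field_simps)
      then show ?thesis using uv by simp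
    qed
    let ?B = "(\<lambda>j. (lo j, hi j)) ` {..<3}"
    have B: "a n 0 \<le> p \<and> p < q \<and> q \<le> b n 0" if pq: "(p, q) \<in> ?B" for p q
    proof -
      obtain j where j: "j < 3" "p = lo j" "q = hi j" using pq by auto
      have "{lo j..hi j} \<subseteq> K n 0" using odd_fifth_subset[OF uv j(1)] uv_sub[of n] th by blast
      then show ?thesis using j lohi[of j] by auto
    qed
    have "\<exists>h. (\<forall>i. small_change f e (K n i) (K n (Suc i)) (h (Suc i))) \<and>
      (\<forall>(p, q)\<in>?B. nds_iter h (2 ^ n) ` {p..q} = K n (2 ^ n))"
      using r by (intro exists_covering_loop[where r = r] cont ab sub img e B) auto
    then obtain h where "\<And>i. small_change f e (K n i) (K n (Suc i)) (h (Suc i))"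
      "\<forall>(p, q)\<in>?B. nds_iter h (2 ^ n) ` {p..q} = K n (2 ^ n)" by blast
    moreover have "K n (2 ^ n) = K n 0" by (rule per) simp
    ultimately show ?thesis unfolding th by (intro exI[of _ h]) simp
  qed
  then show ?thesis by blast
qed

end

section \<open>Lengths of the blocks\<close>

text \<open>The first \<open>loops_before k\<close> observation times belong to the blocks before block \<open>k\<close>; the
  factorial makes block \<open>k\<close> outweigh all of them.\<close>
definition loops_before :: "nat \<Rightarrow> nat" where "loops_before k = fact (Suc k) - 1"

definition num_loops :: "nat \<Rightarrow> nat" where "num_loops k = loops_before (Suc k) - loops_before k"

lemma loops_before_Suc: "loops_before (Suc k) = loops_before k + num_loops k" and num_loops_pos: "num_loops k > 0"
proof -
  have "(fact (Suc k) :: nat) < fact (Suc (Suc k))" by (rule fact_less_mono_nat) auto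
  moreover have "(fact (Suc k) :: nat) \<ge> 1" by (rule fact_ge_1)
  ultimately show "loops_before (Suc k) = loops_before k + num_loops k" "num_loops k > 0" unfolding num_loops_def loops_before_def by linarith+
qed

lemma loops_before_0: "loops_before 0 = 0" by (simp add: loops_before_def)

lemma strict_mono_loops_before: "strict_mono loops_before"
  using loops_before_Suc num_loops_pos by (simp add: strict_mono_Suc_iff)

text \<open>The share of block \<open>k\<close> among all observations up to its end tends to 1.
  With x = (k+1)! and c = k+2 it is (c x - x)/(c x - 1), and dropping the 1 gives 1 - 1/c.\<close>

lemma num_loops_over_loops_before: "real (num_loops k) / real (loops_before (Suc k)) \<ge> 1 - 1 / real (Suc (Suc k))"
proof -
  define x c where "x = real (fact (Suc k))" and "c = real (Suc (Suc k))"
  have ge: "(fact (Suc k) :: nat) \<ge> 1" "(fact (Suc (Suc k)) :: nat) \<ge> 1" by (rule fact_ge_1)+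
  have "real (fact (Suc (Suc k))) = c * x"
    unfolding fact_Suc[of "Suc k"] x_def c_def by (simp only: of_nat_mult of_nat_id)
  then have before: "real (loops_before (Suc k)) = c * x - 1" "real (loops_before k) = x - 1"
    unfolding loops_before_def x_def using ge by (simp_all only: of_nat_diff of_nat_1)
  then have loops: "real (num_loops k) = c * x - x" using loops_before_Suc[of k] by linarith
  have "0 < real (loops_before (Suc k))" using num_loops_pos[of k] loops_before_Suc[of k] by simp
  moreover have "(1 - 1 / c) * (c * x - 1) \<le> c * x - x"
  proof -
    have c: "c \<ge> 2" unfolding c_def by simp
    then have "(1 - 1 / c) * (c * x - 1) = c * x - x - (1 - 1 / c)" by (simp add: field_simps)
    moreover have "1 / c \<le> 1" using c by simp
    ultimately show ?thesis by linarith
  qed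
  ultimately show ?thesis unfolding loops before(1) c_def[symmetric] by (simp add: pos_le_divide_eq)
qed

section \<open>The nonautonomous sequence and its orbits\<close>

text \<open>The condition \<open>gap\<close> lets the \<open>num_loops k\<close> turns of block
  \<open>k\<close>, begun no later than time \<open>2 ^ \<nu> k\<close>, finish before block
  \<open>k + 1\<close> starts.\<close>

locale perturbed_cycles = nested_cycles +
  fixes \<nu> :: "nat \<Rightarrow> nat" and H :: "nat \<Rightarrow> nat \<Rightarrow> real \<Rightarrow> real"
  assumes level_pos: "1 \<le> \<nu> k"
    and level_mono: "\<nu> k < \<nu> (Suc k)"
    and gap: "(num_loops k + 1) * 2 ^ \<nu> k \<le> 2 ^ (\<nu> (Suc k) - 1)"
    and change: "small_change f (1 / real (Suc k)) (K (\<nu> k) i) (K (\<nu> k) (Suc i)) (H k (Suc i))"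
    and cover: "j < 3 \<Longrightarrow> nds_iter (H k) (2 ^ \<nu> k) ` odd_fifth u v j = K (\<nu> k) 0"
begin

definition start :: "nat \<Rightarrow> nat" where "start k = 2 ^ (\<nu> k - 1)"

abbreviation period :: "nat \<Rightarrow> nat" where "period k \<equiv> 2 ^ \<nu> k"

definition active :: "nat \<Rightarrow> nat \<Rightarrow> bool" where
  "active t k \<longleftrightarrow> start k \<le> t \<and> t < start k + num_loops k * period k"

text \<open>The shift by one reflects that \<open>fs (Suc t)\<close> acts on the state at time
  \<open>t\<close>; \<open>THE\<close> is justified by the disjointness of the blocks.\<close>

definition fs :: "nat \<Rightarrow> real \<Rightarrow> real" where
  "fs s = (if \<exists>k. active (s - 1) k
     then let k = THE k. active (s - 1) k in H k (Suc ((s - 1 - start k) mod period k)) else f)"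

lemma start_Suc: "start k + num_loops k * period k \<le> start (Suc k)"
proof -
  have "start k \<le> period k" unfolding start_def by (rule power_increasing) auto
  moreover have "num_loops k * period k + period k \<le> start (Suc k)" using gap[of k] unfolding start_def by simp
  ultimately show ?thesis by linarith
qed

lemma mono_start: "k \<le> k' \<Longrightarrow> start k \<le> start k'"
  by (rule lift_Suc_mono_le[of start]) (use start_Suc in \<open>auto intro: order_trans[OF le_add1]\<close>)

lemma block_end_le_start: "k < k' \<Longrightarrow> start k + num_loops k * period k \<le> start k'"
  using start_Suc[of k] mono_start[of "Suc k" k'] by linarith

lemma active_unique: "active t k \<Longrightarrow> active t k' \<Longrightarrow> k = k'"
  using block_end_le_start[of k k'] block_end_le_start[of k' k] unfolding active_def
  by (cases k k' rule: linorder_cases) auto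

lemma fs_active: "active t k \<Longrightarrow> fs (Suc t) = H k (Suc ((t - start k) mod period k))"
proof -
  assume k: "active t k"
  then have "(THE k. active t k) = k" using active_unique by blast
  then show ?thesis using k by (auto simp: fs_def)
qed

lemma fs_inactive: "(\<And>k. \<not> active t k) \<Longrightarrow> fs (Suc t) = f"
  by (simp add: fs_def)

lemma small_change_fs:
  assumes "active t k"
  shows "small_change f (1 / real (Suc k)) (K (\<nu> k) (t - start k)) (K (\<nu> k) (Suc (t - start k))) (fs (Suc t))"
proof -
  have 1: "K (\<nu> k) ((t - start k) mod period k) = K (\<nu> k) (t - start k)" by (rule per) simp
  have 2: "K (\<nu> k) (Suc ((t - start k) mod period k)) = K (\<nu> k) (Suc (t - start k))"
    by (rule per) (simp add: mod_Suc_eq)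
  show ?thesis
    using change[of k "(t - start k) mod period k"] unfolding 1 2 fs_active[OF assms] .
qed

lemma fs_continuous_onto: "continuous_on unitI (fs (Suc t)) \<and> fs (Suc t) ` unitI = unitI"
proof (cases "\<exists>k. active t k")
  case True
  then obtain k where k: "active t k" by blast
  note sc = small_change_fs[OF k]
  have "fs (Suc t) ` unitI = f ` unitI"
    using image_eq_of_small_change[OF _ sub] sc img by metis
  then show ?thesis using sc surj unfolding small_change_def by simp
next
  case False
  then show ?thesis using fs_inactive cont surj by simp
qed

lemma nds_iter_fs_onto: "nds_iter fs t ` unitI = unitI"
  using image_nds_iter[of t fs "\<lambda>_. unitI"] fs_continuous_onto by blast

lemma nds_iter_fs_mem: "x \<in> unitI \<Longrightarrow> nds_iter fs t x \<in> unitI"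
  using nds_iter_fs_onto by blast

text \<open>From \<open>start k0\<close> on only blocks \<open>k >= k0\<close> can be active, and
  these change \<open>f\<close> by less than \<open>1 / (k0 + 1)\<close>.\<close>

lemma uniform_limit_fs: "uniform_limit unitI (\<lambda>n. fs (Suc n)) f sequentially"
proof (rule uniform_limitI)
  fix e :: real assume e: "e > 0"
  obtain k0 :: nat where k0: "1 / real (Suc k0) < e" using nat_approx_posE[OF e] by blast
  have "dist (fs (Suc t) x) (f x) < e" if t: "t \<ge> start k0" and x: "x \<in> unitI" for t x
  proof (cases "\<exists>k. active t k")
    case True
    then obtain k where k: "active t k" by blast
    have "k0 \<le> k" using k t block_end_le_start[of k k0] unfolding active_def by (cases "k < k0") auto
    then have "1 / real (Suc k) \<le> 1 / real (Suc k0)" by (simp add: frac_le)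
    moreover have "\<bar>fs (Suc t) x - f x\<bar> < 1 / real (Suc k)"
      using small_change_fs[OF k] x unfolding small_change_def by blast
    ultimately show ?thesis using k0 by (simp add: dist_real_def)
  next
    case False
    then show ?thesis using fs_inactive e by simp
  qed
  then show "\<forall>\<^sub>F n in sequentially. \<forall>x\<in>unitI. dist (fs (Suc n) x) (f x) < e"
    unfolding eventually_sequentially by blast
qed

lemma level_less: "k < k' \<Longrightarrow> \<nu> k < \<nu> k'"
  by (rule lift_Suc_mono_less[of \<nu>]) (auto simp: level_mono)

text \<open>After \<open>start k\<close> only blocks with levels at least \<open>\<nu> k\<close>
  act. A point that they move lies in a finer interval inside interval \<open>j\<close>, and it
  lands in the next finer interval, which lies inside interval \<open>j + 1\<close>.\<close>

lemma fs_preserves_level: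
  assumes t: "start k \<le> t" and x: "x \<in> K (\<nu> k) j"
  shows "fs (Suc t) x \<in> K (\<nu> k) (Suc j)"
proof -
  have fx: "f x \<in> K (\<nu> k) (Suc j)" using x img by blast
  show ?thesis
  proof (cases "\<exists>k'. active t k'")
    case True
    then obtain k' where k': "active t k'" by blast
    let ?i = "t - start k'"
    have kk': "k \<le> k'" using k' t block_end_le_start[of k' k] unfolding active_def by (cases "k' < k") auto
    then have lev: "\<nu> k \<le> \<nu> k'" using level_less[of k k'] by (cases "k = k'") auto
    note sc = small_change_fs[OF k', unfolded small_change_def]
    show ?thesis
    proof (cases "x \<in> K (\<nu> k') ?i")
      case True
      then have "fs (Suc t) x \<in> K (\<nu> k') (Suc ?i)" using sc by blast
      then have "fs (Suc t) x \<in> K (\<nu> k) (Suc ?i)" using K_antimono[OF lev] by blast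
      moreover have "?i mod 2 ^ \<nu> k = j mod 2 ^ \<nu> k"
        using True x K_antimono[OF lev] by (intro disj) blast
      then have "Suc ?i mod 2 ^ \<nu> k = Suc j mod 2 ^ \<nu> k" by (metis mod_Suc_eq)
      then have "K (\<nu> k) (Suc ?i) = K (\<nu> k) (Suc j)" by (rule per)
      ultimately show ?thesis by blast
    next
      case False
      then have "fs (Suc t) x = f x" using sc by blast
      then show ?thesis using fx by simp
    qed
  next
    case False
    then show ?thesis using fs_inactive fx by simp
  qed
qed

text \<open>Block \<open>k\<close> and a later block \<open>k'\<close> cannot move the same point: \<open>start k'\<close> is divisible by
  \<open>2 ^ \<nu> k\<close>, \<open>start k\<close> is not.\<close>
lemma eventually_autonomous: "\<exists>T. \<forall>t\<ge>T. fs (Suc t) (nds_iter fs t x) = f (nds_iter fs t x)"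
proof (cases "\<exists>t k. active t k \<and> nds_iter fs t x \<in> K (\<nu> k) (t - start k)")
  case False
  have "fs (Suc t) (nds_iter fs t x) = f (nds_iter fs t x)" for t
  proof (cases "\<exists>k. active t k")
    case True
    then obtain k where k: "active t k" by blast
    then have "nds_iter fs t x \<notin> K (\<nu> k) (t - start k)" using False by blast
    then show ?thesis using small_change_fs[OF k] unfolding small_change_def by blast
  next
    case False
    then show ?thesis using fs_inactive by simp
  qed
  then show ?thesis by blast
next
  case True
  then obtain s k where k: "active s k" and x: "nds_iter fs s x \<in> K (\<nu> k) (s - start k)" by blast
  have s: "start k \<le> s" using k unfolding active_def by simp
  \<comment> \<open>From time \<open>s\<close> on, the position in the cycle of level
    \<open>\<nu> k\<close> advances in step with time.\<close>
  have stay: "nds_iter fs (s + i) x \<in> K (\<nu> k) (s + i - start k)" for i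
  proof (induction i)
    case 0
    then show ?case using x by simp
  next
    case (Suc i)
    have "fs (Suc (s + i)) (nds_iter fs (s + i) x) \<in> K (\<nu> k) (Suc (s + i - start k))"
      using s by (intro fs_preserves_level Suc.IH) simp
    then show ?case using s by (simp add: Suc_diff_le)
  qed
  have "fs (Suc t) (nds_iter fs t x) = f (nds_iter fs t x)" if t: "t \<ge> start k + num_loops k * period k" for t
  proof (cases "\<exists>k'. active t k'")
    case True
    then obtain k' where k': "active t k'" by blast
    have kk': "k < k'"
    proof (rule ccontr)
      assume "\<not> k < k'"
      then show False using k' t block_end_le_start[of k' k] unfolding active_def by (cases "k = k'") auto
    qed
    have ts: "s \<le> t" "start k \<le> t" "start k' \<le> t" using k k' t unfolding active_def by auto
    have "nds_iter fs t x \<notin> K (\<nu> k') (t - start k')"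
    proof
      assume "nds_iter fs t x \<in> K (\<nu> k') (t - start k')"
      then have "nds_iter fs t x \<in> K (\<nu> k) (t - start k')"
        using K_antimono[OF less_imp_le[OF level_less[OF kk']]] by blast
      moreover have "nds_iter fs t x \<in> K (\<nu> k) (t - start k)" using stay[of "t - s"] ts by simp
      \<comment> \<open>The two positions of the same point at level \<open>\<nu> k\<close> force
        \<open>start k\<close> and \<open>start k'\<close> to agree modulo
        \<open>2 ^ \<nu> k\<close>.\<close>
      ultimately have "(t - start k') mod 2 ^ \<nu> k = (t - start k) mod 2 ^ \<nu> k" by (intro disj) blast
      moreover have "t - start k = (t - start k') + (start k' - start k)"
        using ts mono_start[of k k'] kk' by simp
      ultimately have "2 ^ \<nu> k dvd start k' - start k"
        by (metis add_diff_cancel_left' le_add1 mod_eq_dvd_iff_nat)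
      moreover have "2 ^ \<nu> k dvd start k'"
        unfolding start_def using level_less[OF kk'] by (intro le_imp_power_dvd) simp
      ultimately have "2 ^ \<nu> k dvd start k"
        using mono_start[of k k'] kk' by (metis dvd_diffD1 less_imp_le)
      then have "(2::nat) ^ \<nu> k \<le> 2 ^ (\<nu> k - 1)" unfolding start_def by (rule dvd_imp_le) simp
      then have "\<nu> k \<le> \<nu> k - 1" by simp
      then show False using level_pos[of k] by simp
    qed
    then show ?thesis using small_change_fs[OF k'] unfolding small_change_def by blast
  next
    case False
    then show ?thesis using fs_inactive by simp
  qed
  then show ?thesis by blast
qed

section \<open>Lower bound for the sequence entropy\<close>

lemma nds_iter_fs_block:
  "l \<le> num_loops k \<Longrightarrow> nds_iter fs (start k + l * period k) x = (nds_iter (H k) (period k) ^^ l) (nds_iter fs (start k) x)"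
proof (induction l)
  case (Suc l)
  let ?s = "start k + l * period k"
  have "nds_iter (\<lambda>j. fs (?s + j)) (period k) = nds_iter (H k) (period k)"
  proof (rule nds_iter_cong)
    fix i assume i: "i < period k"
    have "l * period k + i < Suc l * period k" using i by simp
    also have "\<dots> \<le> num_loops k * period k" using Suc.prems by (intro mult_right_mono) auto
    finally have "active (?s + i) k" unfolding active_def by simp
    then have "fs (Suc (?s + i)) = H k (Suc ((l * period k + i) mod period k))" using fs_active by fastforce
    then show "fs (?s + Suc i) = H k (Suc i)" using i by simp
  qed
  then have "nds_iter fs (?s + period k) x = nds_iter (H k) (period k) (nds_iter fs ?s x)"
    by (simp only: nds_iter_add)
  then show ?case using Suc by (simp add: algebra_simps)
qed simp

text \<open>The \<open>k\<close> for which \<open>j\<close> lies between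
  \<open>loops_before k\<close> (included) and \<open>loops_before (Suc k)\<close>
  (excluded).\<close>

definition block_of :: "nat \<Rightarrow> nat" where "block_of j = (LEAST k. j < loops_before (Suc k))"

text \<open>Observations are made at the beginning of each turn of each block.\<close>

definition obs_time :: "nat \<Rightarrow> nat" where "obs_time j = start (block_of j) + (j - loops_before (block_of j)) * period (block_of j)"

lemma block_of_eq: "loops_before k \<le> j \<Longrightarrow> j < loops_before (Suc k) \<Longrightarrow> block_of j = k"
  unfolding block_of_def
proof (rule Least_equality)
  fix i assume "loops_before k \<le> j" "j < loops_before (Suc i)"
  then have "loops_before k < loops_before (Suc i)" by simp
  then show "k \<le> i" using strict_mono_less[OF strict_mono_loops_before] by simp
qed

lemma block_of: "loops_before (block_of j) \<le> j" "j < loops_before (Suc (block_of j))"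
proof -
  have "j \<le> loops_before j" using strict_mono_imp_increasing[OF strict_mono_loops_before] .
  also have "\<dots> < loops_before (Suc j)" using strict_mono_loops_before by (simp add: strict_mono_Suc_iff)
  finally have ex: "j < loops_before (Suc j)" .
  then show "j < loops_before (Suc (block_of j))" unfolding block_of_def by (rule LeastI)
  show "loops_before (block_of j) \<le> j"
  proof (cases "block_of j")
    case 0
    then show ?thesis by (simp add: loops_before_0)
  next
    case (Suc k)
    then have "\<not> j < loops_before (Suc k)" using not_less_Least[of k "\<lambda>k. j < loops_before (Suc k)"] unfolding block_of_def by simp
    then show ?thesis using Suc by simp
  qed
qed

lemma obs_time_block: "l < num_loops k \<Longrightarrow> obs_time (loops_before k + l) = start k + l * period k"
  unfolding obs_time_def using block_of_eq[of k "loops_before k + l"] loops_before_Suc[of k] by simp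

lemma obs_time_pos: "obs_time j > 0"
  unfolding obs_time_def start_def by simp

lemma strict_mono_obs_time: "strict_mono obs_time"
  unfolding strict_mono_Suc_iff
proof
  fix j
  obtain k l where k: "j = loops_before k + l" "l < num_loops k"
    using block_of[of j] loops_before_Suc[of "block_of j"] by (metis add_less_cancel_left le_iff_add)
  show "obs_time j < obs_time (Suc j)"
  proof (cases "Suc l < num_loops k")
    case True
    then show ?thesis using k obs_time_block[of l k] obs_time_block[of "Suc l" k] by simp
  next
    case False
    \<comment> \<open>After the last turn of a block the next observation is the start of the next
      block, which is not before the end of this one.\<close>
    then have "Suc j = loops_before (Suc k) + 0" using k loops_before_Suc[of k] by simp
    then have "obs_time (Suc j) = start (Suc k)" using obs_time_block[OF num_loops_pos, of "Suc k"] by simp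
    moreover have "l * period k < num_loops k * period k" using k by simp
    ultimately show ?thesis using start_Suc[of k] obs_time_block[OF k(2)] unfolding k(1) by linarith
  qed
qed

text \<open>Each word of length \<open>num_loops k\<close> over three letters is followed by some
  point during block \<open>k\<close>. Points of different words are in different odd fifths at some
  observation.\<close>

lemma sep_num_block: "3 ^ num_loops k \<le> sep_num fs obs_time (loops_before (Suc k)) ((v - u) / 10)"
proof -
  let ?W = "PiE {..<num_loops k} (\<lambda>_. {..<3::nat})"
  let ?\<Phi> = "nds_iter (H k) (period k)"
  have "\<exists>z\<in>unitI. \<forall>l<num_loops k. nds_iter fs (obs_time (loops_before k + l)) z \<in> odd_fifth u v (w l)" if w: "w \<in> ?W" for w
  proof -
    \<comment> \<open>Letters beyond the block default to 0, since \<open>covering_itinerary\<close>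
      takes an infinite word.\<close>
    let ?w = "\<lambda>l. if l < num_loops k then w l else 0"
    have w3: "?w l < 3" for l using w by (auto simp: PiE_iff)
    have "\<exists>x\<in>K (\<nu> k) 0. \<forall>l<num_loops k. (?\<Phi> ^^ l) x \<in> odd_fifth u v (?w l)"
    proof (rule covering_itinerary)
      show "odd_fifth u v j \<subseteq> K (\<nu> k) 0 \<and> ?\<Phi> ` odd_fifth u v j = K (\<nu> k) 0" if "j < 3" for j
        using odd_fifth_subset[OF uv that] uv_sub[of "\<nu> k"] cover[OF that] by blast
      show "K (\<nu> k) 0 \<noteq> {}" using ab[of "\<nu> k" 0] by simp
      show "?w l < 3" for l by (rule w3)
    qed
    then obtain x where x: "x \<in> K (\<nu> k) 0" "\<And>l. l < num_loops k \<Longrightarrow> (?\<Phi> ^^ l) x \<in> odd_fifth u v (w l)" by force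
    \<comment> \<open>The state wanted at the start of the block is reached from some initial point
      because all earlier maps are onto.\<close>
    then obtain z where "z \<in> unitI" "nds_iter fs (start k) z = x"
      using sub nds_iter_fs_onto by (metis imageE subsetD)
    then show ?thesis using x obs_time_block nds_iter_fs_block by (intro bexI[of _ z]) auto
  qed
  then obtain z where z: "\<And>w. w \<in> ?W \<Longrightarrow> z w \<in> unitI"
    "\<And>w l. w \<in> ?W \<Longrightarrow> l < num_loops k \<Longrightarrow> nds_iter fs (obs_time (loops_before k + l)) (z w) \<in> odd_fifth u v (w l)" by metis
  have apart: "\<exists>j<loops_before (Suc k). \<bar>nds_iter fs (obs_time j) (z w) - nds_iter fs (obs_time j) (z w')\<bar> > (v - u) / 10"
    if w: "w \<in> ?W" "w' \<in> ?W" "w \<noteq> w'" for w w'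
  proof -
    obtain l where l: "l < num_loops k" "w l \<noteq> w' l" using w by (metis PiE_ext lessThan_iff)
    then show ?thesis using odd_fifth_separated[OF uv z(2)[OF w(1)] z(2)[OF w(2)]] loops_before_Suc[of k]
      by (intro exI[of _ "loops_before k + l"]) auto
  qed
  have "inj_on z ?W"
  proof (rule inj_onI, rule ccontr)
    fix w w' assume "w \<in> ?W" "w' \<in> ?W" "z w = z w'" "w \<noteq> w'"
    then show False using apart[of w w'] uv by auto
  qed
  then have "card (z ` ?W) = card ?W" by (rule card_image)
  also have "\<dots> = 3 ^ num_loops k" by (simp add: card_PiE)
  finally have "card (z ` ?W) = 3 ^ num_loops k" .
  moreover have "card (z ` ?W) \<le> sep_num fs obs_time (loops_before (Suc k)) ((v - u) / 10)"
  proof (rule card_le_sep_num)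
    show "finite (z ` ?W)" by (intro finite_imageI finite_PiE) auto
    show "separated fs obs_time (loops_before (Suc k)) ((v - u) / 10) (z ` ?W)"
      unfolding separated_def using z(1) apart by blast
    show "(v - u) / 10 > 0" using uv by simp
    show "nds_iter fs j x \<in> unitI" if "x \<in> unitI" for j x using nds_iter_fs_mem[OF that] .
  qed
  ultimately show ?thesis by simp
qed

text \<open>It suffices to fix the scale \<open>(v - u) / 10\<close> and to look along the
  subsequence of block ends, where the quotient is at least
  \<open>(1 - 1 / (k + 2)) * ln 3\<close>.\<close>

lemma seq_entropy_fs: "seq_entropy fs obs_time \<ge> ereal (ln 3)"
proof -
  let ?e = "(v - u) / 10"
  let ?h = "\<lambda>n. ereal (ln (real (sep_num fs obs_time n ?e)) / real n)"
  have "ereal ((1 - 1 / real (Suc (Suc k))) * ln 3) \<le> (?h \<circ> (loops_before \<circ> Suc)) k" for k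
  proof -
    have "real (3 ^ num_loops k) \<le> real (sep_num fs obs_time (loops_before (Suc k)) ?e)"
      using sep_num_block[of k] by (simp only: of_nat_le_iff)
    then have "ln (3 ^ num_loops k) \<le> ln (real (sep_num fs obs_time (loops_before (Suc k)) ?e))"
      by (intro ln_mono) auto
    then have "real (num_loops k) * ln 3 \<le> ln (real (sep_num fs obs_time (loops_before (Suc k)) ?e))"
      by (simp add: ln_realpow)
    then have "real (num_loops k) / real (loops_before (Suc k)) * ln 3 \<le> ln (real (sep_num fs obs_time (loops_before (Suc k)) ?e)) / real (loops_before (Suc k))"
      by (simp add: divide_right_mono)
    moreover have "(1 - 1 / real (Suc (Suc k))) * ln 3 \<le> real (num_loops k) / real (loops_before (Suc k)) * ln 3"
      by (intro mult_right_mono num_loops_over_loops_before) simp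
    ultimately show ?thesis by simp
  qed
  then have "limsup (\<lambda>k. ereal ((1 - 1 / real (Suc (Suc k))) * ln 3)) \<le> limsup (?h \<circ> (loops_before \<circ> Suc))"
    by (intro Limsup_mono) auto
  moreover have "(\<lambda>k. ereal ((1 - 1 / real (Suc (Suc k))) * ln 3)) \<longlonglongrightarrow> ereal (ln 3)"
  proof -
    have "(\<lambda>k. 1 / real (Suc (Suc k))) \<longlonglongrightarrow> 0"
      using LIMSEQ_Suc[OF LIMSEQ_inverse_real_of_nat] by (simp add: inverse_eq_divide)
    then have "(\<lambda>k. (1 - 1 / real (Suc (Suc k))) * ln 3) \<longlonglongrightarrow> (1 - 0) * ln 3"
      by (intro tendsto_intros)
    then show ?thesis by simp
  qed
  then have "limsup (\<lambda>k. ereal ((1 - 1 / real (Suc (Suc k))) * ln 3)) = ereal (ln 3)"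
    by (intro lim_imp_Limsup) auto
  moreover have "limsup (?h \<circ> (loops_before \<circ> Suc)) \<le> limsup ?h"
    using strict_mono_loops_before by (intro limsup_subseq_mono) (simp add: strict_mono_def)
  ultimately have "ereal (ln 3) \<le> limsup ?h" by simp
  also have "\<dots> \<le> seq_entropy fs obs_time"
    unfolding seq_entropy_def using uv by (intro SUP_upper) simp
  finally show ?thesis .
qed

end

section \<open>Choice of the levels\<close>

lemma (in nested_cycles) exists_perturbed_cycles: "\<exists>\<nu> H. perturbed_cycles f a b u v \<nu> H"
proof -
  let ?good = "\<lambda>k n h. (\<forall>i. small_change f (1 / real (Suc k)) (K n i) (K n (Suc i)) (h (Suc i))) \<and>
    (\<forall>j<3. nds_iter h (2 ^ n) ` odd_fifth u v j = K n 0)"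
  have "\<forall>k. \<exists>n0. \<forall>n\<ge>n0. \<exists>h. ?good k n h" by (intro allI exists_loop) simp
  then obtain n0 where n0: "\<And>k n. n \<ge> n0 k \<Longrightarrow> \<exists>h. ?good k n h" by metis
  have "\<exists>\<nu>. \<forall>k. (n0 k \<le> \<nu> k \<and> 1 \<le> \<nu> k) \<and>
      (\<nu> k < \<nu> (Suc k) \<and> (num_loops k + 1) * 2 ^ \<nu> k \<le> 2 ^ (\<nu> (Suc k) - 1))"
  proof (rule dependent_nat_choice)
    show "\<exists>n. n0 0 \<le> n \<and> 1 \<le> n" by (intro exI[of _ "Suc (n0 0)"]) simp
    fix n k assume "n0 k \<le> n \<and> 1 \<le> n"
    let ?X = "(num_loops k + 1) * 2 ^ n"
    \<comment> \<open>The summand \<open>?X\<close> secures \<open>gap\<close> through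
      \<open>?X <= 2 ^ ?X\<close>; the others secure growth and the threshold for tolerance
      \<open>1 / (k + 2)\<close>.\<close>
    let ?n' = "Suc (?X + n + n0 (Suc k))"
    have "?X \<le> 2 ^ ?X" by (rule less_imp_le) (rule less_exp)
    also have "\<dots> \<le> 2 ^ (?n' - 1)" by (rule power_increasing) auto
    finally show "\<exists>n'. (n0 (Suc k) \<le> n' \<and> 1 \<le> n') \<and> (n < n' \<and> ?X \<le> 2 ^ (n' - 1))"
      by (intro exI[of _ ?n']) simp
  qed
  then obtain \<nu> where \<nu>: "\<And>k. n0 k \<le> \<nu> k" "\<And>k. 1 \<le> \<nu> k" "\<And>k. \<nu> k < \<nu> (Suc k)"
    "\<And>k. (num_loops k + 1) * 2 ^ \<nu> k \<le> 2 ^ (\<nu> (Suc k) - 1)" by blast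
  have "\<forall>k. \<exists>h. ?good k (\<nu> k) h" using n0 \<nu>(1) by blast
  then obtain H where H: "\<And>k. ?good k (\<nu> k) (H k)" by metis
  have "perturbed_cycles f a b u v \<nu> H"
  proof unfold_locales
    fix k i j :: nat
    show "1 \<le> \<nu> k" "\<nu> k < \<nu> (Suc k)" "(num_loops k + 1) * 2 ^ \<nu> k \<le> 2 ^ (\<nu> (Suc k) - 1)"
      using \<nu> by blast+
    show "small_change f (1 / real (Suc k)) (K (\<nu> k) i) (K (\<nu> k) (Suc i)) (H k (Suc i))"
      using H[of k] by blast
    show "nds_iter (H k) (2 ^ \<nu> k) ` odd_fifth u v j = K (\<nu> k) 0" if "j < 3"
      using H[of k] that by blast
  qed
  then show ?thesis by blast
qed

section \<open>From the simple set to nested cycles\<close>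

lemma connected_subset_one_of_disjoint_closed:
  assumes X: "connected X" "X \<noteq> {}" and cover: "X \<subseteq> (\<Union>i<m. B i)"
    and closed: "\<And>i. i < m \<Longrightarrow> closed (B i)"
    and disj: "\<And>i j. i < m \<Longrightarrow> j < (m::nat) \<Longrightarrow> i \<noteq> j \<Longrightarrow> B i \<inter> B j = {}"
  shows "\<exists>i<m. X \<subseteq> B i"
proof -
  obtain x where x: "x \<in> X" using X(2) by blast
  then obtain i where i: "i < m" "x \<in> B i" using cover by blast
  let ?C = "\<Union>j\<in>{..<m} - {i}. B j"
  have "closed ?C" using closed by (intro closed_UN) auto
  moreover have "X \<subseteq> B i \<union> ?C" using cover by blast
  moreover have "B i \<inter> ?C \<inter> X = {}" using disj i(1) by blast
  ultimately have "?C \<inter> X = {}"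
    using X(1) closed[OF i(1)] x i(2) unfolding connected_closed by blast
  then show ?thesis using \<open>X \<subseteq> B i \<union> ?C\<close> i(1) by blast
qed

text \<open>An interval [u,v] inside the simple set lies, by connectedness, in a single interval of
  each cycle. Renumbering every cycle from that interval gives the required indexing.\<close>

lemma nested_cycles_of_assoc_system:
  assumes cont: "continuous_on unitI f" and surj: "f ` unitI = unitI"
    and J: "assoc_system f W J" and intM: "interior (simple_set_of J) \<noteq> {}"
  shows "\<exists>a b u v. nested_cycles f a b u v"
proof -
  define B where "B n i = (f ^^ i) ` J n 0" for n i
  have pint: "periodic_interval f (2 ^ n) (J n 0)" and Jk: "k < 2 ^ n \<Longrightarrow> J n k = B n k"
    and Jn: "J (Suc n) 0 \<subseteq> J n 0" for n k
    using J unfolding assoc_system_def B_def by blast+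
  have B_add: "(f ^^ j) ` B n i = B n (j + i)" for j n i
    unfolding B_def by (simp add: funpow_add image_comp)
  have B_Suc: "f ` B n i = B n (Suc i)" for n i using B_add[of 1 n i] by simp
  have B_per: "B n (2 ^ n * q + i) = B n i" for n q i
  proof (induction q)
    case (Suc q)
    have "B n (2 ^ n) = B n 0" using pint[of n] unfolding periodic_interval_def B_def by simp
    have "B n (2 ^ n * Suc q + i) = (f ^^ (2 ^ n * q + i)) ` B n (2 ^ n)"
      unfolding B_add by (simp add: algebra_simps)
    also have "\<dots> = B n (2 ^ n * q + i)" unfolding \<open>B n (2 ^ n) = B n 0\<close> B_add by simp
    finally show ?case using Suc by simp
  qed simp
  have B_mod: "B n (i mod 2 ^ n) = B n i" for n i
    using B_per[of n "i div 2 ^ n" "i mod 2 ^ n"] by simp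
  have B_disj: "i mod 2 ^ n = j mod 2 ^ n" if "B n i \<inter> B n j \<noteq> {}" for n i j
  proof (rule ccontr)
    assume ne: "i mod 2 ^ n \<noteq> j mod 2 ^ n"
    have "i mod 2 ^ n < 2 ^ n" "j mod 2 ^ n < 2 ^ n" by simp_all
    then have "B n (i mod 2 ^ n) \<inter> B n (j mod 2 ^ n) = {}"
      using pint[of n] ne unfolding periodic_interval_def B_def by blast
    then show False using that unfolding B_mod by blast
  qed
  have B_int: "B n i \<subseteq> unitI \<and> (\<exists>a b. a \<le> b \<and> B n i = {a..b})" for n i
  proof (induction i)
    case 0
    then show ?case using pint[of n] unfolding periodic_interval_def B_def by auto
  next
    case (Suc i)
    then obtain a b where ab: "a \<le> b" "B n i = {a..b}" "{a..b} \<subseteq> unitI" by auto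
    have "continuous_on {a..b} f" using cont ab(3) continuous_on_subset by blast
    then obtain c d where cd: "f ` {a..b} = {c..d}" "c \<le> d"
      using continuous_image_closed_interval[OF ab(1)] by blast
    have B: "B n (Suc i) = f ` {a..b}" using B_Suc[of n i] ab(2) by simp
    have "f ` {a..b} \<subseteq> unitI" using ab(3) surj by blast
    then show ?case unfolding B using cd by blast
  qed
  obtain x where "x \<in> interior (simple_set_of J)" using intM by blast
  then obtain e where e: "e > 0" "cball x e \<subseteq> simple_set_of J"
    using mem_interior_cball by blast
  define u v where "u = x - e" and "v = x + e"
  have uv: "u < v" "{u..v} \<subseteq> simple_set_of J"
    using e unfolding u_def v_def by (auto simp: cball_eq_atLeastAtMost)
  have "\<exists>i<2 ^ n. {u..v} \<subseteq> B n i" for n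
  proof (rule connected_subset_one_of_disjoint_closed)
    show "{u..v} \<subseteq> (\<Union>i<2 ^ n. B n i)" using uv(2) Jk unfolding simple_set_of_def by auto
    show "closed (B n i)" for i using B_int[of n i] by auto
    show "B n i \<inter> B n j = {}" if "i < 2 ^ n" "j < 2 ^ n" "i \<noteq> j" for i j
      using B_disj[of n i j] that by auto
  qed (use uv in auto)
  then obtain s where s: "\<And>n. {u..v} \<subseteq> B n (s n)" by metis
  \<comment> \<open>The shift by \<open>s n\<close> gives index 0 to the interval containing
    [u,v].\<close>
  define c where "c n i = B n (s n + i)" for n i
  have "\<exists>a b. a < b \<and> c n i = {a..b}" for n i
  proof -
    obtain a b where ab: "a \<le> b" "c n i = {a..b}" using B_int[of n "s n + i"] unfolding c_def by blast
    moreover have "a \<noteq> b"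
    proof
      assume "a = b"
      then have single: "c n i = {a}" using ab by simp
      have "B n (s n) = B n (2 ^ n * i + s n)" using B_per by simp
      \<comment> \<open>A further \<open>(2 ^ n - 1) * i\<close> steps take interval
        \<open>i\<close> back to interval 0. If interval \<open>i\<close> were a point, [u,v] would
        lie in a point.\<close>
      also have "2 ^ n * i + s n = (2 ^ n - 1) * i + (s n + i)"
      proof -
        have "2 ^ n * i = (2 ^ n - 1) * i + i" by (simp add: diff_mult_distrib)
        then show ?thesis by simp
      qed
      also have "B n \<dots> = (f ^^ ((2 ^ n - 1) * i)) ` c n i" unfolding c_def B_add ..
      finally have "{u..v} \<subseteq> {(f ^^ ((2 ^ n - 1) * i)) a}" using s[of n] single by simp
      moreover have "u \<in> {u..v}" "v \<in> {u..v}" using uv(1) by auto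
      ultimately have "u = v" by blast
      then show False using uv(1) by simp
    qed
    ultimately show ?thesis by (intro exI[of _ a] exI[of _ b]) simp
  qed
  then obtain a b where ab: "\<And>n i. a n i < b n i" "\<And>n i. c n i = {a n i..b n i}" by metis
  have "nested_cycles f a b u v"
  proof (unfold_locales, unfold ab(2)[symmetric])
    fix n i j :: nat
    show "continuous_on unitI f" "f ` unitI = unitI" "u < v" "a n i < b n i"
      by (fact cont surj uv(1) ab(1))+
    show "c n i \<subseteq> unitI" unfolding c_def using B_int by blast
    show "f ` c n i = c n (Suc i)" unfolding c_def B_Suc by simp
    show "i mod 2 ^ n = j mod 2 ^ n" if "c n i \<inter> c n j \<noteq> {}"
    proof -
      have "(s n + i) mod 2 ^ n = (s n + j) mod 2 ^ n" using that unfolding c_def by (rule B_disj)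
      then show ?thesis unfolding nat_mod_eq_iff by (simp add: add.assoc)
    qed
    show "c n i = c n j" if "i mod 2 ^ n = j mod 2 ^ n"
    proof -
      have "(s n + i) mod 2 ^ n = (s n + j) mod 2 ^ n" using that by (metis mod_add_right_eq)
      then show ?thesis unfolding c_def by (metis B_mod)
    qed
    show "c (Suc n) i \<subseteq> c n i"
    proof -
      have sub: "B (Suc n) k \<subseteq> B n k" for k unfolding B_def using Jn by (rule image_mono)
      \<comment> \<open>Nesting is given for the unshifted indices. The common point
        \<open>u\<close> forces the shifts of consecutive levels to agree modulo
        \<open>2 ^ n\<close>, so it carries over to the shifted ones.\<close>
      have "u \<in> B n (s (Suc n)) \<inter> B n (s n)" using s[of n] s[of "Suc n"] sub uv(1) by force
      then have "s (Suc n) mod 2 ^ n = s n mod 2 ^ n" by (intro B_disj) blast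
      then have "(s (Suc n) + i) mod 2 ^ n = (s n + i) mod 2 ^ n" by (metis mod_add_left_eq)
      then have "B n (s (Suc n) + i) = B n (s n + i)" by (metis B_mod)
      then show ?thesis unfolding c_def using sub by blast
    qed
    show "{u..v} \<subseteq> c n 0" using s unfolding c_def by simp
  qed
  then show ?thesis by blast
qed

theorem mainTheorem5:
  fixes f :: "real \<Rightarrow> real"
  assumes cont: "continuous_on unitI f"
    and surj: "f ` unitI = unitI"
    and one_inf: "\<exists>!W. infinite W \<and> is_omega_limit_set f W"
    and Wt: "infinite Wt" "is_omega_limit_set f Wt"
    and h0: "top_entropy f = 0"
    and notLY: "\<not> li_yorke_chaotic (\<lambda>_. f)"
    and J: "assoc_system f Wt J"
    and intM: "interior (simple_set_of J) \<noteq> {}"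
    and G: "inj G" "range G = {C \<in> components (simple_set_of J). \<not> (\<exists>c. C = {c})}"
      "\<forall>n::int. f ` G n = G (n + 1)"
  shows "\<exists>fs :: nat \<Rightarrow> real \<Rightarrow> real.
           (\<forall>n\<ge>1. continuous_on unitI (fs n) \<and> fs n ` unitI = unitI)
         \<and> uniform_limit unitI (\<lambda>n. fs (Suc n)) f sequentially
         \<and> (\<exists>S. strict_mono S \<and> (\<forall>i. S i > 0) \<and> seq_entropy fs S \<ge> ereal (ln 3))
         \<and> \<not> li_yorke_chaotic fs"
proof -
  obtain a b u v where "nested_cycles f a b u v"
    using nested_cycles_of_assoc_system[OF cont surj J intM] by blast
  then obtain \<nu> H where "perturbed_cycles f a b u v \<nu> H"
    using nested_cycles.exists_perturbed_cycles by blast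
  then interpret perturbed_cycles f a b u v \<nu> H .
  have "\<forall>n\<ge>1. continuous_on unitI (fs n) \<and> fs n ` unitI = unitI"
  proof (intro allI impI)
    fix n :: nat assume "n \<ge> 1"
    then show "continuous_on unitI (fs n) \<and> fs n ` unitI = unitI"
      using fs_continuous_onto[of "n - 1"] by simp
  qed
  moreover have "\<not> li_yorke_chaotic fs"
    using not_li_yorke_chaotic_if_eventually_autonomous[OF notLY] nds_iter_fs_mem eventually_autonomous
    by blast
  ultimately show ?thesis
    using uniform_limit_fs strict_mono_obs_time obs_time_pos seq_entropy_fs by blast
qed

end
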